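(* Let $[\alpha,\beta],[a,b]\subseteq\overline{\mathbb{R}}$, let $I=[\alpha,\beta]\times[a,b]$ and let $f\colon I\to\mathbb{R}$. Suppose $f(\cdot\,,y)$ is a $\mathcal{LP}$-primitive on $[\alpha,\beta]$ for a.e. $y\in(a,b)$. Let $F(x)=\int_a^b f(x,y)\,dy$ for $x\in[\alpha,\beta]$ (it being understood that these Laplace integrals exist, so that $F$ is a function $[\alpha,\beta]\to\mathbb{R}$). Then [$F$ is a $\mathcal{LP}$-primitive on $[\alpha,\beta]$ and $LD_1F(x)=\int_a^b LD_{1x}f(x,y)\,dy$ for almost every $x\in(\alpha,\beta)$] if and only if $$\int_s^t\int_a^b LD_{1x}f(x,y)\,dy\,dx=\int_a^b\int_s^t LD_{1x}f(x,y)\,dx\,dy\qquad\text{for all } s,t\in[\alpha,\beta].$$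
   Context: $\overline{\mathbb{R}}=[-\infty,\infty]$. All integrals are Laplace integrals, defined as follows. Laplace derivates: for a continuous function $U$ on a compact interval and a point $x$ of it, take $\delta>0$ small and put $\underline{LD}_1^{+}U(x)=\liminf_{s\to\infty}s^2\int_0^\delta e^{-st}[U(x+t)-U(x)]\,dt$ and $\underline{LD}_1^{-}U(x)=\liminf_{s\to\infty}(-s^2)\int_0^\delta e^{-st}[U(x-t)-U(x)]\,dt$ (these do not depend on $\delta$); $\underline{LD}_1U(x)$ is the minimum of the two. $\overline{LD}_1U(x)$ is defined with $\limsup$ and maximum. At endpoints only the available one-sided expression is used. Laplace integral on a compact interval $[p,q]\subset\mathbb{R}$: for $f:[p,q]\to\mathbb{R}$, a major (resp. minor) function is a continuous $U$ (resp. $V$) on $[p,q]$ with $\underline{LD}_1U\ge f$, $\underline{LD}_1U>-\infty$ (resp. $\overline{LD}_1V\le f$, $\overline{LD}_1V<\infty$) everywhere on $[p,q]$. $f$ is Laplace integrable on $[p,q]$ if it has major and minor functions and $\inf_U(U(q)-U(p))=\sup_V(V(q)-V(p))$ is finite; the common value is $\int_p^q f$. Unbounded intervals: $f$ is Laplace integrable on $[p,\infty]$ (equivalently $[p,\infty)$), $p\in\mathbb{R}$, if it is Laplace integrable on $[p,c]$ for all $c\ge p$ and $\int_p^\infty f:=\lim_{c\to\infty}\int_p^c f$ exists (finite); similarly on $[-\infty,q]$. It is integrable on $\mathbb{R}$ (or $\overline{\mathbb{R}}$) if for some $p\in\mathbb{R}$ it is integrable on $(-\infty,p]$ and $[p,\infty)$,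 and then $\int_{-\infty}^\infty f=\int_{-\infty}^p f+\int_p^\infty f$. $\mathcal{LP}(I)$ is the set of Laplace integrable functions on $I$. Laplace derivative: if $f$ is Laplace integrable on a neighbourhood of $x$ and for some $\delta>0$ the limits $\lim_{s\to\infty}s^2\int_0^\delta e^{-st}[f(x+t)-f(x)]\,dt$ and $\lim_{s\to\infty}(-s^2)\int_0^\delta e^{-st}[f(x-t)-f(x)]\,dt$ exist and are equal, the common value is $LD_1f(x)$. For a function $f(x,y)$, $LD_{1x}f$ is the Laplace derivative in $x$ with $y$ held constant. $\mathcal{LP}$-primitive: for $J=[c,d]\subseteq\overline{\mathbb{R}}$, a continuous $F:J\to\mathbb{R}$ is a $\mathcal{LP}$-primitive on $J$ if $LD_1F$ exists a.e. on $J$, $LD_1F\in\mathcal{LP}(J)$ and $\int_u^v LD_1F=F(v)-F(u)$ for all $u,v\in J$. *)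

theory Defs
  imports "HOL-Analysis.Analysis"
begin

text \<open>
  The integrals in the derivates below are integrals of continuous functions, so the
  Henstock-Kurzweil integral of the library yields their Riemann values.
\<close>

definition lower_LD_right :: "real \<Rightarrow> (real \<Rightarrow> real) \<Rightarrow> real \<Rightarrow> ereal" where
  "lower_LD_right \<delta> U x =
     Liminf at_top (\<lambda>s::real. ereal (s\<^sup>2 * integral {0..\<delta>} (\<lambda>t. exp (- s * t) * (U (x + t) - U x))))"

definition lower_LD_left :: "real \<Rightarrow> (real \<Rightarrow> real) \<Rightarrow> real \<Rightarrow> ereal" where
  "lower_LD_left \<delta> U x =
     Liminf at_top (\<lambda>s::real. ereal (- s\<^sup>2 * integral {0..\<delta>} (\<lambda>t. exp (- s * t) * (U (x - t) - U x))))"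

definition upper_LD_right :: "real \<Rightarrow> (real \<Rightarrow> real) \<Rightarrow> real \<Rightarrow> ereal" where
  "upper_LD_right \<delta> U x =
     Limsup at_top (\<lambda>s::real. ereal (s\<^sup>2 * integral {0..\<delta>} (\<lambda>t. exp (- s * t) * (U (x + t) - U x))))"

definition upper_LD_left :: "real \<Rightarrow> (real \<Rightarrow> real) \<Rightarrow> real \<Rightarrow> ereal" where
  "upper_LD_left \<delta> U x =
     Limsup at_top (\<lambda>s::real. ereal (- s\<^sup>2 * integral {0..\<delta>} (\<lambda>t. exp (- s * t) * (U (x - t) - U x))))"

text \<open>
  Derivates of a continuous function on \<open>[p, q]\<close>.  They do not depend on \<open>\<delta>\<close>; we take the
  largest \<open>\<delta>\<close> that keeps the argument inside \<open>[p, q]\<close>.  A side that is not available at an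
  endpoint contributes the neutral element of \<open>min\<close> or \<open>max\<close>.
\<close>

definition lower_LD :: "real \<Rightarrow> real \<Rightarrow> (real \<Rightarrow> real) \<Rightarrow> real \<Rightarrow> ereal" where
  "lower_LD p q U x =
     min (if x < q then lower_LD_right (q - x) U x else \<infinity>)
         (if p < x then lower_LD_left (x - p) U x else \<infinity>)"

definition upper_LD :: "real \<Rightarrow> real \<Rightarrow> (real \<Rightarrow> real) \<Rightarrow> real \<Rightarrow> ereal" where
  "upper_LD p q U x =
     max (if x < q then upper_LD_right (q - x) U x else -\<infinity>)
         (if p < x then upper_LD_left (x - p) U x else -\<infinity>)"

definition major_functions :: "(real \<Rightarrow> real) \<Rightarrow> real \<Rightarrow> real \<Rightarrow> (real \<Rightarrow> real) set" where
  "major_functions f p q =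
     {U. continuous_on {p..q} U \<and>
         (\<forall>x\<in>{p..q}. lower_LD p q U x \<ge> ereal (f x) \<and> lower_LD p q U x > -\<infinity>)}"

definition minor_functions :: "(real \<Rightarrow> real) \<Rightarrow> real \<Rightarrow> real \<Rightarrow> (real \<Rightarrow> real) set" where
  "minor_functions f p q =
     {V. continuous_on {p..q} V \<and>
         (\<forall>x\<in>{p..q}. upper_LD p q V x \<le> ereal (f x) \<and> upper_LD p q V x < \<infinity>)}"

text \<open>
  \<open>has_LP_integral f a b I\<close>: the Laplace integral of \<open>f\<close> from \<open>a\<close> to \<open>b\<close> exists and equals
  \<open>I\<close>.  The integrand lives on \<open>real\<close> because its values at \<open>\<plusminus>\<infinity>\<close> are irrelevant.  The last two
  rules are the usual conventions for equal and for reversed limits of integration.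
\<close>

inductive has_LP_integral :: "(real \<Rightarrow> real) \<Rightarrow> ereal \<Rightarrow> ereal \<Rightarrow> real \<Rightarrow> bool" for f where
  compact:
    "\<lbrakk>p \<le> q; major_functions f p q \<noteq> {}; minor_functions f p q \<noteq> {};
      (INF U\<in>major_functions f p q. ereal (U q - U p)) = ereal I;
      (SUP V\<in>minor_functions f p q. ereal (V q - V p)) = ereal I\<rbrakk>
     \<Longrightarrow> has_LP_integral f (ereal p) (ereal q) I"
| to_PInf:
    "\<lbrakk>\<And>c. p \<le> c \<Longrightarrow> has_LP_integral f (ereal p) (ereal c) (J c); (J \<longlongrightarrow> I) at_top\<rbrakk>
     \<Longrightarrow> has_LP_integral f (ereal p) \<infinity> I"
| from_MInf:
    "\<lbrakk>\<And>c. c \<le> q \<Longrightarrow> has_LP_integral f (ereal c) (ereal q) (J c); (J \<longlongrightarrow> I) at_bot\<rbrakk>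
     \<Longrightarrow> has_LP_integral f (-\<infinity>) (ereal q) I"
| whole_line:
    "\<lbrakk>has_LP_integral f (-\<infinity>) (ereal p) I; has_LP_integral f (ereal p) \<infinity> J\<rbrakk>
     \<Longrightarrow> has_LP_integral f (-\<infinity>) \<infinity> (I + J)"
| degenerate: "has_LP_integral f a a 0"
| reversed: "\<lbrakk>a < b; has_LP_integral f a b I\<rbrakk> \<Longrightarrow> has_LP_integral f b a (- I)"

text \<open>
  Laplace integral of an almost everywhere defined function, given by its graph \<open>P\<close>
  (\<open>P x v\<close>: the function is defined at \<open>x\<close> with value \<open>v\<close>): it is integrated through
  an everywhere defined function that agrees with it almost everywhere between the limits.
  Since \<open>has_ae_LP_integral P a b\<close> is again the graph of a partially defined quantity,
  iterated integrals are written by nesting.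
\<close>

definition has_ae_LP_integral :: "(real \<Rightarrow> real \<Rightarrow> bool) \<Rightarrow> ereal \<Rightarrow> ereal \<Rightarrow> real \<Rightarrow> bool" where
  "has_ae_LP_integral P a b I \<longleftrightarrow>
     (\<exists>g. (AE x in lebesgue. min a b < ereal x \<and> ereal x < max a b \<longrightarrow> P x (g x)) \<and>
          has_LP_integral g a b I)"

text \<open>
  \<open>has_LD1 c d f x l\<close>: the function \<open>f\<close> with domain \<open>[c, d]\<close> has Laplace derivative \<open>l\<close> at
  \<open>x\<close>.  The inclusion keeps the values of \<open>f\<close> outside its domain out of play.
  \<open>R s\<close> and \<open>L s\<close> are the Laplace integrals whose limits are taken.
\<close>

definition has_LD1 :: "ereal \<Rightarrow> ereal \<Rightarrow> (ereal \<Rightarrow> real) \<Rightarrow> real \<Rightarrow> real \<Rightarrow> bool" where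
  "has_LD1 c d f x l \<longleftrightarrow>
     (\<exists>\<delta>>0. {ereal (x - \<delta>)..ereal (x + \<delta>)} \<subseteq> {c..d} \<and>
        (\<exists>I. has_LP_integral (\<lambda>t. f (ereal t)) (ereal (x - \<delta>)) (ereal (x + \<delta>)) I) \<and>
        (\<exists>R. (\<forall>\<^sub>F s in at_top. has_LP_integral
                (\<lambda>t. exp (- s * t) * (f (ereal (x + t)) - f (ereal x))) 0 (ereal \<delta>) (R s)) \<and>
             ((\<lambda>s::real. s\<^sup>2 * R s) \<longlongrightarrow> l) at_top) \<and>
        (\<exists>L. (\<forall>\<^sub>F s in at_top. has_LP_integral
                (\<lambda>t. exp (- s * t) * (f (ereal (x - t)) - f (ereal x))) 0 (ereal \<delta>) (L s)) \<and>
             ((\<lambda>s::real. - s\<^sup>2 * L s) \<longlongrightarrow> l) at_top))"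

definition LP_primitive :: "ereal \<Rightarrow> ereal \<Rightarrow> (ereal \<Rightarrow> real) \<Rightarrow> bool" where
  "LP_primitive c d F \<longleftrightarrow>
     continuous_on {c..d} F \<and>
     (AE x in lebesgue. c < ereal x \<and> ereal x < d \<longrightarrow> (\<exists>l. has_LD1 c d F x l)) \<and>
     (\<exists>I. has_ae_LP_integral (has_LD1 c d F) c d I) \<and>
     (\<forall>u\<in>{c..d}. \<forall>v\<in>{c..d}. has_ae_LP_integral (has_LD1 c d F) u v (F v - F u))"

end

theory Submission
  imports Defs "HOL-Real_Asymp.Real_Asymp"
begin

text \<open>
  For fixed \<open>y\<close> the section \<open>f (\<cdot>, y)\<close> is a primitive, so integrating its derivative in \<open>x\<close> from \<open>s\<close>
  to \<open>t\<close> gives \<open>f (t, y) - f (s, y)\<close>, and integrating this in \<open>y\<close> gives \<open>F t - F s\<close>. One of the two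
  iterated integrals thus always exists with value \<open>F t - F s\<close>. Let \<open>G x\<close> be the integral in \<open>y\<close> of
  the partial derivative at \<open>x\<close>. The equality of the iterated integrals says that the integral of
  \<open>G\<close> from \<open>s\<close> to \<open>t\<close> is \<open>F t - F s\<close> for all \<open>s\<close> and \<open>t\<close>, that is, that \<open>F\<close> is an indefinite
  integral of \<open>G\<close>. If \<open>F\<close> is a primitive with derivative \<open>G\<close> almost everywhere, this holds by
  definition. Conversely, an indefinite Laplace integral is continuous and almost everywhere has the
  integrand as its Laplace derivative, so \<open>F\<close> is a primitive with derivative \<open>G\<close>.

  The substance is therefore the fundamental theorem for the Laplace integral, together with the
  uniqueness of integrals of functions that are given almost everywhere only. A continuous function
  with nonnegative right Laplace derivates is monotone (\<open>mono_if_right_laplace_nonneg\<close>), so a major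
  function minus a minor function is monotone. Hence the indefinite integral \<open>\<Phi>\<close> exists as a
  uniform limit of major functions \<open>U\<close> for which \<open>U - \<Phi>\<close> is monotone and has small total increase
  (\<open>LP_compact_primitive\<close>). By a covering argument such a monotone function is steep only on a
  small set (\<open>monotone_steep_set_cover\<close>), so outside a small set the derivates of \<open>\<Phi>\<close> are, up to a small
  error, no less than those of \<open>U\<close> (\<open>major_approximable_derivate_ae\<close>); the same argument applied to
  \<open>- f\<close> gives the upper bound. Changing the integrand on a null set costs a monotone function of
  small increase and infinite slope on that set (\<open>null_set_steep_function\<close>). Integrals over
  unbounded intervals are reduced to compact ones by continuous indefinite integrals on the extended
  line (\<open>has_LP_integral_iff_indefinite\<close>).
\<close>

section \<open>Laplace transforms of increments\<close>

text \<open>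
  The quantity whose lower and upper limits, as \<open>s\<close> tends to infinity, are the Laplace
  derivates. The weight \<open>s\<^sup>2 * t * exp (- s * t)\<close> has mass tending to \<open>1\<close> and concentrates at
  \<open>0\<close>, so for \<open>w t\<close> close to \<open>l * t\<close> the quotient is close to \<open>l\<close>.
\<close>
definition laplace_quotient :: "real \<Rightarrow> (real \<Rightarrow> real) \<Rightarrow> real \<Rightarrow> real" where
  "laplace_quotient \<delta> w s = s\<^sup>2 * integral {0..\<delta>} (\<lambda>t. exp (- s * t) * w t)"

lemma laplace_quotient_cong:
  assumes "\<And>t. t \<in> {0..\<delta>} \<Longrightarrow> v t = w t"
  shows "laplace_quotient \<delta> v = laplace_quotient \<delta> w"
  unfolding laplace_quotient_def using assms by (auto intro!: ext Henstock_Kurzweil_Integration.integral_cong)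

lemma integrable_laplace_kernel:
  fixes w :: "real \<Rightarrow> real"
  assumes "continuous_on {c..d} w"
  shows "(\<lambda>t. exp (- s * t) * w t) integrable_on {c..d}"
  by (intro integrable_continuous_real continuous_intros assms)

lemma laplace_quotient_add:
  assumes "continuous_on {0..\<delta>} v" "continuous_on {0..\<delta>} w"
  shows "laplace_quotient \<delta> (\<lambda>t. v t + w t) s = laplace_quotient \<delta> v s + laplace_quotient \<delta> w s"
  using integral_add[OF integrable_laplace_kernel[OF assms(1), of s] integrable_laplace_kernel[OF assms(2), of s]]
  by (simp add: laplace_quotient_def algebra_simps)

lemma laplace_quotient_minus:
  "laplace_quotient \<delta> (\<lambda>t. - w t) s = - laplace_quotient \<delta> w s"
  by (simp add: laplace_quotient_def)

text \<open>
  Away from \<open>0\<close> the factor \<open>exp (- s * t)\<close> beats \<open>s\<^sup>2\<close>, so for a continuous function only the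
  behaviour near \<open>0\<close> matters. All later changes of the length \<open>\<delta>\<close> rest on this.
\<close>
lemma laplace_quotient_local:
  assumes w: "continuous_on {0..\<delta>} w" and \<eta>: "0 < \<eta>" "\<eta> \<le> \<delta>"
  shows "((\<lambda>s. laplace_quotient \<delta> w s - laplace_quotient \<eta> w s) \<longlongrightarrow> 0) at_top"
proof -
  have "bounded (w ` {0..\<delta>})"
    using w compact_Icc compact_continuous_image compact_imp_bounded by blast
  then obtain M where M: "\<And>t. t \<in> {0..\<delta>} \<Longrightarrow> \<bar>w t\<bar> \<le> M"
    by (force simp: bounded_iff)
  have w': "continuous_on {\<eta>..\<delta>} w"
    using w \<eta> by (auto intro: continuous_on_subset)
  have M0: "0 \<le> M"
    using M[of \<eta>] \<eta> by auto
  have bound: "norm (laplace_quotient \<delta> w s - laplace_quotient \<eta> w s) \<le> s\<^sup>2 * exp (- s * \<eta>) * (M * (\<delta> - \<eta>))"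
    if "0 \<le> s" for s
  proof -
    have "integral {0..\<delta>} (\<lambda>t. exp (- s * t) * w t) =
        integral {0..\<eta>} (\<lambda>t. exp (- s * t) * w t) + integral {\<eta>..\<delta>} (\<lambda>t. exp (- s * t) * w t)"
      using \<eta> w by (intro Henstock_Kurzweil_Integration.integral_combine[symmetric] integrable_laplace_kernel) auto
    then have "laplace_quotient \<delta> w s - laplace_quotient \<eta> w s =
        s\<^sup>2 * integral {\<eta>..\<delta>} (\<lambda>t. exp (- s * t) * w t)"
      by (simp add: laplace_quotient_def algebra_simps)
    moreover have "norm (integral {\<eta>..\<delta>} (\<lambda>t. exp (- s * t) * w t)) \<le> exp (- s * \<eta>) * M * (\<delta> - \<eta>)"
    proof (rule integral_bound)
      fix t assume t: "t \<in> {\<eta>..\<delta>}"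
      have "exp (- s * t) * \<bar>w t\<bar> \<le> exp (- s * \<eta>) * M"
        using t that \<eta> M[of t] by (intro mult_mono) (auto simp: mult_left_mono)
      then show "norm (exp (- s * t) * w t) \<le> exp (- s * \<eta>) * M"
        by (simp add: abs_mult)
    qed (use \<eta> w' in \<open>auto intro!: continuous_intros\<close>)
    ultimately show ?thesis
      by (simp add: abs_mult mult.assoc mult_left_mono)
  qed
  have "((\<lambda>s. s\<^sup>2 * exp (- s * \<eta>) * (M * (\<delta> - \<eta>))) \<longlongrightarrow> 0) at_top"
    using \<eta>(1) by real_asymp
  then show ?thesis
    by (rule Lim_null_comparison[rotated]) (rule eventually_mono[OF eventually_ge_at_top[of 0] bound])
qed

text \<open>
  The normalisation: a function with slope \<open>c\<close> has Laplace derivative \<open>c\<close>.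
\<close>
lemma laplace_quotient_ident:
  assumes "0 < \<delta>"
  shows "(laplace_quotient \<delta> (\<lambda>t. t) \<longlongrightarrow> 1) at_top"
proof -
  have eq: "laplace_quotient \<delta> (\<lambda>t. t) s = 1 - exp (- s * \<delta>) * (s * \<delta> + 1)" if "0 < s" for s
  proof -
    \<comment> \<open>\<open>- exp (- s * t) * (t / s + 1 / s\<^sup>2)\<close> is an antiderivative of the integrand.\<close>
    have "((\<lambda>t. exp (- s * t) * t) has_integral
        (- exp (- s * \<delta>) * (\<delta> / s + 1 / s\<^sup>2) - (- exp (- s * 0) * (0 / s + 1 / s\<^sup>2)))) {0..\<delta>}"
      using assms that
      by (intro fundamental_theorem_of_calculus)
         (auto intro!: derivative_eq_intros simp: field_simps power2_eq_square
               simp flip: has_real_derivative_iff_has_vector_derivative)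
    from integral_unique[OF this] show ?thesis
      using that by (simp add: laplace_quotient_def field_simps power2_eq_square)
  qed
  have "((\<lambda>s. 1 - exp (- s * \<delta>) * (s * \<delta> + 1)) \<longlongrightarrow> 1) at_top"
    using assms by real_asymp
  then show ?thesis
    by (rule Lim_transform_eventually)
       (rule eventually_mono[OF eventually_gt_at_top[of 0]], simp only: eq)
qed

text \<open>
  A lower bound for the lower limit of the quotients, kept inside the reals so that lower
  bounds can be added without case distinctions on infinite limits.
\<close>
definition laplace_ge :: "real \<Rightarrow> (real \<Rightarrow> real) \<Rightarrow> real \<Rightarrow> bool" where
  "laplace_ge \<delta> w c \<longleftrightarrow> (\<forall>d<c. \<forall>\<^sub>F s in at_top. d < laplace_quotient \<delta> w s)"

lemma laplace_ge_mono: "laplace_ge \<delta> w c \<Longrightarrow> d \<le> c \<Longrightarrow> laplace_ge \<delta> w d"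
  by (auto simp: laplace_ge_def)

lemma laplace_ge_cong:
  assumes "\<And>t. t \<in> {0..\<delta>} \<Longrightarrow> v t = w t"
  shows "laplace_ge \<delta> v c \<longleftrightarrow> laplace_ge \<delta> w c"
  unfolding laplace_ge_def using laplace_quotient_cong[OF assms] by simp

lemma laplace_ge_add:
  assumes "continuous_on {0..\<delta>} v" "continuous_on {0..\<delta>} w"
    and "laplace_ge \<delta> v c" "laplace_ge \<delta> w d"
  shows "laplace_ge \<delta> (\<lambda>t. v t + w t) (c + d)"
  unfolding laplace_ge_def laplace_quotient_add[OF assms(1,2)]
proof (intro allI impI)
  fix e assume e: "e < c + d"
  define h where "h = (c + d - e) / 2"
  have "\<forall>\<^sub>F s in at_top. c - h < laplace_quotient \<delta> v s" "\<forall>\<^sub>F s in at_top. d - h < laplace_quotient \<delta> w s"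
    using assms(3,4) e by (auto simp: laplace_ge_def h_def)
  then show "\<forall>\<^sub>F s in at_top. e < laplace_quotient \<delta> v s + laplace_quotient \<delta> w s"
    by eventually_elim (auto simp: h_def field_simps)
qed

lemma laplace_ge_transfer:
  assumes "((\<lambda>s. laplace_quotient \<delta> w s - laplace_quotient \<eta> w s) \<longlongrightarrow> 0) at_top"
    and "laplace_ge \<eta> w c"
  shows "laplace_ge \<delta> w c"
  unfolding laplace_ge_def
proof (intro allI impI)
  fix d assume d: "d < c"
  have "\<forall>\<^sub>F s in at_top. (d + c) / 2 < laplace_quotient \<eta> w s"
    using assms(2) d unfolding laplace_ge_def by (metis gt_half_sum add.commute one_add_one)
  moreover have "\<forall>\<^sub>F s in at_top. (d - c) / 2 < laplace_quotient \<delta> w s - laplace_quotient \<eta> w s"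
    using d by (intro order_tendstoD(1)[OF assms(1)]) simp
  ultimately show "\<forall>\<^sub>F s in at_top. d < laplace_quotient \<delta> w s"
    by eventually_elim (simp add: field_simps)
qed

lemma laplace_ge_local:
  assumes "continuous_on {0..\<delta>} w" "0 < \<eta>" "\<eta> \<le> \<delta>"
  shows "laplace_ge \<delta> w c \<longleftrightarrow> laplace_ge \<eta> w c"
proof -
  have lim: "((\<lambda>s. laplace_quotient \<delta> w s - laplace_quotient \<eta> w s) \<longlongrightarrow> 0) at_top"
    by (rule laplace_quotient_local[OF assms])
  from tendsto_minus[OF this] have "((\<lambda>s. laplace_quotient \<eta> w s - laplace_quotient \<delta> w s) \<longlongrightarrow> 0) at_top"
    by simp
  with lim show ?thesis
    by (blast intro: laplace_ge_transfer)
qed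

text \<open>
  Ordinary lower slopes bound Laplace derivates; this is how every concrete derivate below
  is estimated.
\<close>
lemma laplace_geI:
  assumes w: "continuous_on {0..\<delta>} w" and \<eta>: "0 < \<eta>" "\<eta> \<le> \<delta>"
    and le: "\<And>t. t \<in> {0..\<eta>} \<Longrightarrow> c * t \<le> w t"
  shows "laplace_ge \<delta> w c"
proof -
  have w': "continuous_on {0..\<eta>} w"
    using w \<eta> by (auto intro: continuous_on_subset)
  have "c * laplace_quotient \<eta> (\<lambda>t. t) s \<le> laplace_quotient \<eta> w s" for s
  proof -
    have "integral {0..\<eta>} (\<lambda>t. exp (- s * t) * (c * t)) \<le> integral {0..\<eta>} (\<lambda>t. exp (- s * t) * w t)"
      by (intro integral_le integrable_laplace_kernel w' continuous_intros mult_left_mono le) auto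
    moreover have "integral {0..\<eta>} (\<lambda>t. exp (- s * t) * (c * t)) = c * integral {0..\<eta>} (\<lambda>t. exp (- s * t) * t)"
      by (simp add: mult.left_commute[of _ c])
    ultimately show ?thesis
      using mult_left_mono[of "c * integral {0..\<eta>} (\<lambda>t. exp (- s * t) * t)" _ "s\<^sup>2"]
      by (simp add: laplace_quotient_def mult.left_commute[of c])
  qed
  note le_quotient = this
  have lim: "((\<lambda>s. c * laplace_quotient \<eta> (\<lambda>t. t) s) \<longlongrightarrow> c * 1) at_top"
    by (intro tendsto_intros laplace_quotient_ident \<eta>)
  have "laplace_ge \<eta> w c"
    unfolding laplace_ge_def
  proof (intro allI impI)
    fix d assume "d < c"
    then have "\<forall>\<^sub>F s in at_top. d < c * laplace_quotient \<eta> (\<lambda>t. t) s"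
      by (intro order_tendstoD(1)[OF lim]) simp
    then show "\<forall>\<^sub>F s in at_top. d < laplace_quotient \<eta> w s"
      by (rule eventually_mono) (rule less_le_trans[OF _ le_quotient])
  qed
  then show ?thesis
    using laplace_ge_local[OF w \<eta>] by simp
qed

text \<open>
  A function that is nonpositive near \<open>0\<close> has nonpositive quotients up to a vanishing error.
  So a positive derivate forces positive values arbitrarily close to \<open>0\<close>, which is all that
  the monotonicity theorem needs.
\<close>
lemma laplace_ge_posD:
  assumes w: "continuous_on {0..\<delta>} w" and c: "0 < c" "laplace_ge \<delta> w c" and \<eta>: "0 < \<eta>" "\<eta> \<le> \<delta>"
  shows "\<exists>t\<in>{0..\<eta>}. 0 < w t"
proof (rule ccontr)
  assume *: "\<not> ?thesis"
  have "laplace_ge \<delta> (\<lambda>t. - w t) 0"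
    using * by (intro laplace_geI[OF _ \<eta>] continuous_intros w) (force simp: not_less)
  from laplace_ge_add[OF w _ c(2) this]
  have "laplace_ge \<delta> (\<lambda>t. 0) c"
    using w by (simp add: continuous_on_minus)
  then show False
    using c(1) by (auto simp: laplace_ge_def laplace_quotient_def)
qed

text \<open>
  The monotonicity theorem, from right-hand derivates alone. If the derivates are positive and
  the value drops from \<open>p\<close> to \<open>q\<close>, the last point at which the value is still as large as at \<open>p\<close>
  contradicts \<open>laplace_ge_posD\<close>. Nonnegative derivates are made positive by adding a linear function of small
  slope.
\<close>
lemma mono_if_right_laplace_nonneg:
  fixes U :: "real \<Rightarrow> real"
  assumes "p \<le> q" and U: "continuous_on {p..q} U"
    and ge: "\<And>x. x \<in> {p..<q} \<Longrightarrow> laplace_ge (q - x) (\<lambda>t. U (x + t) - U x) 0"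
  shows "U p \<le> U q"
proof -
  have strict: "W p \<le> W q" if W: "continuous_on {p..q} W" and "0 < c"
    and W_ge: "\<And>x. x \<in> {p..<q} \<Longrightarrow> laplace_ge (q - x) (\<lambda>t. W (x + t) - W x) c" for W :: "real \<Rightarrow> real" and c
  proof (rule ccontr)
    assume "\<not> W p \<le> W q"
    then have "W q < W p" by simp
    define S where "S = {x \<in> {p..q}. W p \<le> W x}"
    have S: "closed S" "p \<in> S" "bdd_above S" "S \<subseteq> {p..q}"
      using continuous_on_closed_Collect_le[OF continuous_on_const W closed_atLeastAtMost, of "W p"] \<open>p \<le> q\<close>
      by (auto simp: S_def)
    \<comment> \<open>To the right of \<open>x\<close> the values stay below \<open>W p\<close>, hence below \<open>W x\<close>.\<close>
    define x where "x = Sup S"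
    have x: "x \<in> S"
      unfolding x_def using S by (intro closed_contains_Sup) auto
    with \<open>W q < W p\<close> have "x \<noteq> q"
      by (auto simp: S_def)
    with x S have x': "x \<in> {p..<q}"
      by force
    have "continuous_on {0..q - x} (\<lambda>t. W (x + t) - W x)"
      using x' by (intro continuous_intros continuous_on_compose2[OF W]) auto
    from laplace_ge_posD[OF this \<open>0 < c\<close> W_ge[OF x'], of "q - x"] x'
    obtain t where t: "t \<in> {0..q - x}" "W x < W (x + t)"
      by auto
    then have "t > 0"
      using less_eq_real_def by auto
    moreover have "x + t \<in> S"
      using t x x' by (auto simp: S_def)
    ultimately show False
      using cSup_upper[OF _ S(3), of "x + t"] by (simp add: x_def)
  qed
  have "U p \<le> U q + e * (q - p)" if "0 < e" for e
  proof -
    have "U p + e * p \<le> U q + e * q"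
    proof (rule strict[OF _ \<open>0 < e\<close>])
      fix x assume x: "x \<in> {p..<q}"
      have cont: "continuous_on {0..q - x} (\<lambda>t. U (x + t) - U x)"
        using x by (intro continuous_intros continuous_on_compose2[OF U]) auto
      have "laplace_ge (q - x) (\<lambda>t. e * t) e"
        using x by (intro laplace_geI[where \<eta>="q - x"] continuous_intros) auto
      from laplace_ge_add[OF cont _ ge[OF x] this]
      have "laplace_ge (q - x) (\<lambda>t. U (x + t) - U x + e * t) (0 + e)"
        by (simp add: continuous_intros)
      then show "laplace_ge (q - x) (\<lambda>t. U (x + t) + e * (x + t) - (U x + e * x)) e"
        by (simp add: algebra_simps)
    qed (intro continuous_intros U)
    then show ?thesis by (simp add: algebra_simps)
  qed
  then have "U p \<le> U q + e" if "0 < e" "p < q" for e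
    using that by (metis diff_gt_0_iff_gt divide_pos_pos less_irrefl nonzero_eq_divide_eq)
  then show ?thesis
    using \<open>p \<le> q\<close> by (cases "p = q") (auto intro: field_le_epsilon)
qed

section \<open>Major and minor functions\<close>

text \<open>
  With \<open>\<sigma> = 1\<close> or \<open>\<sigma> = - 1\<close> this treats right and left derivates at once; the outer factor
  \<open>\<sigma>\<close> is the sign in front of the left derivate.
\<close>
definition increment :: "(real \<Rightarrow> real) \<Rightarrow> real \<Rightarrow> real \<Rightarrow> real \<Rightarrow> real" where
  "increment U x \<sigma> t = \<sigma> * (U (x + \<sigma> * t) - U x)"

lemma increment_add: "increment (\<lambda>y. U y + W y) x \<sigma> t = increment U x \<sigma> t + increment W x \<sigma> t"
  by (simp add: increment_def algebra_simps)

lemma increment_minus: "increment (\<lambda>y. - U y) x \<sigma> t = - increment U x \<sigma> t"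
  by (simp add: increment_def algebra_simps)

definition side_within :: "real \<Rightarrow> real \<Rightarrow> real \<Rightarrow> real \<Rightarrow> real \<Rightarrow> bool" where
  "side_within p q x \<sigma> \<delta> \<longleftrightarrow> x \<in> {p..q} \<and> \<sigma> \<in> {1, - 1} \<and> 0 < \<delta> \<and> x + \<sigma> * \<delta> \<in> {p..q}"

lemma side_withinD:
  "side_within p q x \<sigma> \<delta> \<Longrightarrow> t \<in> {0..\<delta>} \<Longrightarrow> x + \<sigma> * t \<in> {p..q}"
  by (auto simp: side_within_def)

lemma continuous_on_increment:
  assumes "continuous_on {p..q} U" "side_within p q x \<sigma> \<delta>"
  shows "continuous_on {0..\<delta>} (increment U x \<sigma>)"
  unfolding increment_def
  by (intro continuous_intros continuous_on_compose2[OF assms(1)]) (use side_withinD[OF assms(2)] in auto)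

text \<open>
  The major functions of \<open>f\<close>, in a form that visibly passes to subintervals: every one-sided
  neighbourhood inside the interval is allowed, not only the largest one. Minor functions are
  the negatives of major functions of \<open>- f\<close>.
\<close>
definition derivate_above :: "(real \<Rightarrow> real) \<Rightarrow> (real \<Rightarrow> real) \<Rightarrow> real \<Rightarrow> real \<Rightarrow> bool" where
  "derivate_above f U p q \<longleftrightarrow> continuous_on {p..q} U \<and>
     (\<forall>x \<sigma> \<delta>. side_within p q x \<sigma> \<delta> \<longrightarrow> laplace_ge \<delta> (increment U x \<sigma>) (f x))"

lemma derivate_aboveD:
  "derivate_above f U p q \<Longrightarrow> side_within p q x \<sigma> \<delta> \<Longrightarrow> laplace_ge \<delta> (increment U x \<sigma>) (f x)"
  "derivate_above f U p q \<Longrightarrow> continuous_on {p..q} U"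
  by (auto simp: derivate_above_def)

text \<open>
  Since derivates are local, an arbitrarily short one-sided neighbourhood suffices.
\<close>
lemma derivate_aboveI:
  assumes U: "continuous_on {p..q} U"
    and "\<And>x \<sigma> \<delta>. side_within p q x \<sigma> \<delta> \<Longrightarrow> \<exists>\<eta>. 0 < \<eta> \<and> \<eta> \<le> \<delta> \<and> laplace_ge \<eta> (increment U x \<sigma>) (f x)"
  shows "derivate_above f U p q"
  unfolding derivate_above_def
  using assms laplace_ge_local[OF continuous_on_increment[OF U]] by blast

lemma derivate_above_subinterval:
  assumes "derivate_above f U p q" "{p'..q'} \<subseteq> {p..q}"
  shows "derivate_above f U p' q'"
  using assms unfolding derivate_above_def side_within_def
  by (blast intro: continuous_on_subset)

lemma derivate_above_add:
  assumes "derivate_above f U p q" "derivate_above g W p q"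
  shows "derivate_above (\<lambda>x. f x + g x) (\<lambda>x. U x + W x) p q"
proof -
  have "laplace_ge \<delta> (increment (\<lambda>x. U x + W x) x \<sigma>) (f x + g x)" if "side_within p q x \<sigma> \<delta>" for x \<sigma> \<delta>
    unfolding increment_add[abs_def] using that assms
    by (intro laplace_ge_add continuous_on_increment) (auto dest: derivate_aboveD)
  then show ?thesis
    using assms by (auto simp: derivate_above_def intro!: continuous_intros)
qed

lemma derivate_above_zero_mono:
  assumes "derivate_above (\<lambda>x. 0) U p q"
  shows "mono_on {p..q} U"
proof (rule mono_onI)
  fix u v assume uv: "u \<in> {p..q}" "v \<in> {p..q}" "u \<le> v"
  then have U: "derivate_above (\<lambda>x. 0) U u v"
    by (intro derivate_above_subinterval[OF assms]) auto
  show "U u \<le> U v"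
  proof (rule mono_if_right_laplace_nonneg[OF uv(3) derivate_aboveD(2)[OF U]])
    fix x assume "x \<in> {u..<v}"
    then have "laplace_ge (v - x) (increment U x 1) 0"
      by (intro derivate_aboveD(1)[OF U]) (auto simp: side_within_def)
    then show "laplace_ge (v - x) (\<lambda>t. U (x + t) - U x) 0"
      by (simp add: increment_def[abs_def])
  qed
qed

text \<open>
  The difference of a major and a minor function is monotone; the minor function enters as
  \<open>- V\<close>. The whole theory of the integral rests on this.
\<close>
lemma derivate_above_opposite_mono:
  assumes "derivate_above f U p q" "derivate_above (\<lambda>x. - f x) V p q"
  shows "mono_on {p..q} (\<lambda>x. U x + V x)"
  using derivate_above_add[OF assms] by (intro derivate_above_zero_mono) simp

lemma laplace_ge_Liminf:
  "laplace_ge \<delta> w c \<longleftrightarrow> ereal c \<le> Liminf at_top (\<lambda>s. ereal (laplace_quotient \<delta> w s))"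
proof
  assume *: "laplace_ge \<delta> w c"
  show "ereal c \<le> Liminf at_top (\<lambda>s. ereal (laplace_quotient \<delta> w s))"
    unfolding le_Liminf_iff
  proof (intro allI impI)
    fix y assume y: "y < ereal c"
    then obtain d where "y \<le> ereal d" "d < c"
      by (metis ereal_dense2 less_ereal.simps(1) less_imp_le)
    then show "\<forall>\<^sub>F s in at_top. y < ereal (laplace_quotient \<delta> w s)"
      using * by (auto simp: laplace_ge_def elim!: allE[of _ d] eventually_mono intro: le_less_trans)
  qed
next
  assume "ereal c \<le> Liminf at_top (\<lambda>s. ereal (laplace_quotient \<delta> w s))"
  then have *: "\<forall>\<^sub>F s in at_top. y < ereal (laplace_quotient \<delta> w s)" if "y < ereal c" for y
    using that by (simp add: le_Liminf_iff)
  show "laplace_ge \<delta> w c"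
    unfolding laplace_ge_def using *[of "ereal _"] by simp
qed

lemma laplace_ge_minus_Limsup:
  "laplace_ge \<delta> (\<lambda>t. - w t) (- c) \<longleftrightarrow> Limsup at_top (\<lambda>s. ereal (laplace_quotient \<delta> w s)) \<le> ereal c"
  unfolding laplace_ge_Liminf laplace_quotient_minus
  using ereal_Liminf_uminus[of at_top "\<lambda>s. ereal (laplace_quotient \<delta> w s)"]
  by (simp only: uminus_ereal.simps(1)[symmetric] ereal_minus_le_minus)

lemma right_left_quotients:
  "s\<^sup>2 * integral {0..\<delta>} (\<lambda>t. exp (- s * t) * (U (x + t) - U x)) = laplace_quotient \<delta> (increment U x 1) s"
  "- s\<^sup>2 * integral {0..\<delta>} (\<lambda>t. exp (- s * t) * (U (x - t) - U x)) = laplace_quotient \<delta> (increment U x (- 1)) s"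
proof -
  have "integral {0..\<delta>} (\<lambda>t. exp (- s * t) * (U x - U (x - t))) =
      - integral {0..\<delta>} (\<lambda>t. exp (- s * t) * (U (x - t) - U x))"
    unfolding Henstock_Kurzweil_Integration.integral_neg[symmetric] by (simp add: algebra_simps)
  then show "- s\<^sup>2 * integral {0..\<delta>} (\<lambda>t. exp (- s * t) * (U (x - t) - U x)) = laplace_quotient \<delta> (increment U x (- 1)) s"
    by (simp add: laplace_quotient_def increment_def)
qed (simp add: laplace_quotient_def increment_def)

lemma LD_eq_laplace_quotient:
  "lower_LD_right \<delta> U x = Liminf at_top (\<lambda>s. ereal (laplace_quotient \<delta> (increment U x 1) s))"
  "lower_LD_left \<delta> U x = Liminf at_top (\<lambda>s. ereal (laplace_quotient \<delta> (increment U x (- 1)) s))"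
  "upper_LD_right \<delta> U x = Limsup at_top (\<lambda>s. ereal (laplace_quotient \<delta> (increment U x 1) s))"
  "upper_LD_left \<delta> U x = Limsup at_top (\<lambda>s. ereal (laplace_quotient \<delta> (increment U x (- 1)) s))"
  by (simp_all only: lower_LD_right_def lower_LD_left_def upper_LD_right_def upper_LD_left_def right_left_quotients)

text \<open>
  By locality, the longest neighbourhood on each side decides about all the shorter ones.
\<close>
lemma side_within_cases:
  assumes U: "continuous_on {p..q} U" and x: "x \<in> {p..q}"
  shows "(\<forall>\<sigma> \<delta>. side_within p q x \<sigma> \<delta> \<longrightarrow> laplace_ge \<delta> (increment U x \<sigma>) c) \<longleftrightarrow>
    (x < q \<longrightarrow> laplace_ge (q - x) (increment U x 1) c) \<and>
    (p < x \<longrightarrow> laplace_ge (x - p) (increment U x (- 1)) c)" (is "?L \<longleftrightarrow> ?R")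
proof
  assume ?L
  then show ?R
    using x by (auto simp: side_within_def)
next
  assume R: ?R
  show ?L
  proof (intro allI impI)
    fix \<sigma> \<delta> assume s: "side_within p q x \<sigma> \<delta>"
    define D where "D = (if \<sigma> = 1 then q - x else x - p)"
    have D: "side_within p q x \<sigma> D" "\<delta> \<le> D" "0 < \<delta>" and "laplace_ge D (increment U x \<sigma>) c"
      using s R by (auto simp: side_within_def D_def)
    then show "laplace_ge \<delta> (increment U x \<sigma>) c"
      using laplace_ge_local[OF continuous_on_increment[OF U D(1)] D(3,2)] by simp
  qed
qed

text \<open>
  A lower derivate that is at least the real number \<open>f x\<close> is greater than \<open>- \<infinity>\<close>, and by locality
  the neighbourhoods that reach the endpoints decide about all others.
\<close>
lemma major_functions_iff: "U \<in> major_functions f p q \<longleftrightarrow> derivate_above f U p q"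
proof -
  have "ereal (f x) \<le> lower_LD p q U x \<and> - \<infinity> < lower_LD p q U x \<longleftrightarrow>
      (\<forall>\<sigma> \<delta>. side_within p q x \<sigma> \<delta> \<longrightarrow> laplace_ge \<delta> (increment U x \<sigma>) (f x))"
    if "continuous_on {p..q} U" "x \<in> {p..q}" for x
    unfolding side_within_cases[OF that]
    unfolding lower_LD_def LD_eq_laplace_quotient laplace_ge_Liminf
    using less_le_trans[of "- \<infinity>" "ereal (f x)"] by auto
  then show ?thesis
    unfolding major_functions_def derivate_above_def by (auto simp: side_within_def)
qed

lemma minor_functions_iff: "V \<in> minor_functions f p q \<longleftrightarrow> derivate_above (\<lambda>x. - f x) (\<lambda>x. - V x) p q"
proof -
  have "upper_LD p q V x \<le> ereal (f x) \<and> upper_LD p q V x < \<infinity> \<longleftrightarrow>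
      (\<forall>\<sigma> \<delta>. side_within p q x \<sigma> \<delta> \<longrightarrow> laplace_ge \<delta> (increment (\<lambda>x. - V x) x \<sigma>) (- f x))"
    if "continuous_on {p..q} V" "x \<in> {p..q}" for x
    unfolding side_within_cases[OF continuous_on_minus[OF that(1)] that(2)]
    unfolding increment_minus[abs_def]
    unfolding upper_LD_def LD_eq_laplace_quotient laplace_ge_minus_Limsup
    using le_less_trans[of _ "ereal (f x)" "\<infinity>"] by auto
  moreover have "continuous_on {p..q} (\<lambda>x. - V x) \<longleftrightarrow> continuous_on {p..q} V"
    using continuous_on_minus[of _ V] continuous_on_minus[of _ "\<lambda>x. - V x"] by auto
  ultimately show ?thesis
    unfolding minor_functions_def derivate_above_def by (auto simp: side_within_def)
qed

section \<open>The Laplace integral on compact intervals\<close>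

text \<open>
  One half of integrability: the infimum over major functions is at most \<open>I\<close>. Everything about
  minor functions follows by applying it to \<open>- f\<close> and \<open>- I\<close>.
\<close>
definition LP_upper_bound :: "(real \<Rightarrow> real) \<Rightarrow> real \<Rightarrow> real \<Rightarrow> real \<Rightarrow> bool" where
  "LP_upper_bound f p q I \<longleftrightarrow> (\<forall>e>0. \<exists>U. derivate_above f U p q \<and> U q - U p \<le> I + e)"

definition LP_compact :: "(real \<Rightarrow> real) \<Rightarrow> real \<Rightarrow> real \<Rightarrow> real \<Rightarrow> bool" where
  "LP_compact f p q I \<longleftrightarrow> p \<le> q \<and> LP_upper_bound f p q I \<and> LP_upper_bound (\<lambda>x. - f x) p q (- I)"

text \<open>
  Increments of major functions dominate those of minor functions, so two approximations within
  \<open>e\<close> of the same number \<open>I\<close> determine both the infimum and the supremum.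
\<close>
lemma LP_compact_iff:
  "LP_compact f p q I \<longleftrightarrow>
     p \<le> q \<and> major_functions f p q \<noteq> {} \<and> minor_functions f p q \<noteq> {} \<and>
     (INF U\<in>major_functions f p q. ereal (U q - U p)) = ereal I \<and>
     (SUP V\<in>minor_functions f p q. ereal (V q - V p)) = ereal I" (is "?L \<longleftrightarrow> ?R")
proof
  assume L: ?L
  then have pq: "p \<le> q" by (simp add: LP_compact_def)
  have major: "\<exists>U\<in>major_functions f p q. U q - U p \<le> I + e" if "0 < e" for e
    using L that unfolding LP_compact_def LP_upper_bound_def Bex_def major_functions_iff by blast
  have minor: "\<exists>V\<in>minor_functions f p q. I - e \<le> V q - V p" if e: "0 < e" for e
  proof -
    obtain V where "derivate_above (\<lambda>x. - f x) V p q" "V q - V p \<le> - I + e"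
      using L e unfolding LP_compact_def LP_upper_bound_def by blast
    then show ?thesis
      by (intro bexI[of _ "\<lambda>x. - V x"]) (auto simp: minor_functions_iff)
  qed
  have le: "V q - V p \<le> U q - U p" if "U \<in> major_functions f p q" "V \<in> minor_functions f p q" for U V
    using mono_onD[OF derivate_above_opposite_mono[of f U p q "\<lambda>x. - V x"], of p q] that pq
    by (auto simp: major_functions_iff minor_functions_iff)
  have ge_I: "I \<le> U q - U p" if "U \<in> major_functions f p q" for U
  proof (rule field_le_epsilon)
    fix e :: real assume "0 < e"
    from minor[OF this] le[OF that] show "I \<le> U q - U p + e" by force
  qed
  have le_I: "V q - V p \<le> I" if "V \<in> minor_functions f p q" for V
  proof (rule field_le_epsilon)
    fix e :: real assume "0 < e"
    from major[OF this] le[OF _ that] show "V q - V p \<le> I + e" by force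
  qed
  have "(INF U\<in>major_functions f p q. ereal (U q - U p)) = ereal I"
  proof (rule antisym)
    show "(INF U\<in>major_functions f p q. ereal (U q - U p)) \<le> ereal I"
    proof (rule ereal_le_epsilon2)
      fix e :: real assume "0 < e"
      with major[OF this] show "(INF U\<in>major_functions f p q. ereal (U q - U p)) \<le> ereal I + ereal e"
        by (auto intro: INF_lower2)
    qed
  qed (auto intro!: INF_greatest ge_I)
  moreover have "(SUP V\<in>minor_functions f p q. ereal (V q - V p)) = ereal I"
  proof (rule antisym)
    show "ereal I \<le> (SUP V\<in>minor_functions f p q. ereal (V q - V p))"
    proof (rule ereal_le_epsilon2)
      fix e :: real assume "0 < e"
      with minor[OF this] obtain V where "V \<in> minor_functions f p q" "I \<le> V q - V p + e" by force
      then have "ereal I \<le> ereal (V q - V p) + ereal e" "ereal (V q - V p) \<le> (SUP V\<in>minor_functions f p q. ereal (V q - V p))"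
        by (auto intro: SUP_upper)
      then show "ereal I \<le> (SUP V\<in>minor_functions f p q. ereal (V q - V p)) + ereal e"
        by (meson add_right_mono order_trans)
    qed
  qed (auto intro!: SUP_least le_I)
  ultimately show ?R
    using pq major[of 1] minor[of 1] by auto
next
  assume R: ?R
  have "\<exists>U. derivate_above f U p q \<and> U q - U p \<le> I + e" if "0 < e" for e
  proof -
    have "(INF U\<in>major_functions f p q. ereal (U q - U p)) < ereal (I + e)"
      using R that by simp
    then show ?thesis
      by (force simp: INF_less_iff major_functions_iff)
  qed
  moreover have "\<exists>U. derivate_above (\<lambda>x. - f x) U p q \<and> U q - U p \<le> - I + e" if "0 < e" for e
  proof -
    have "ereal (I - e) < (SUP V\<in>minor_functions f p q. ereal (V q - V p))"
      using R that by simp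
    then obtain V where "V \<in> minor_functions f p q" "I - e < V q - V p"
      by (auto simp: less_SUP_iff)
    then show ?thesis
      by (intro exI[of _ "\<lambda>x. - V x"]) (auto simp: minor_functions_iff)
  qed
  ultimately show ?L
    using R by (auto simp: LP_compact_def LP_upper_bound_def)
qed

lemma LP_upper_bound_add:
  assumes "LP_upper_bound f p q I" "LP_upper_bound g p q J"
  shows "LP_upper_bound (\<lambda>x. f x + g x) p q (I + J)"
  unfolding LP_upper_bound_def
proof (intro allI impI)
  fix e :: real assume "0 < e"
  then obtain U W where "derivate_above f U p q" "U q - U p \<le> I + e / 2"
      "derivate_above g W p q" "W q - W p \<le> J + e / 2"
    using assms unfolding LP_upper_bound_def by (meson half_gt_zero)
  then show "\<exists>U. derivate_above (\<lambda>x. f x + g x) U p q \<and> U q - U p \<le> I + J + e"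
    by (intro exI[of _ "\<lambda>x. U x + W x"]) (auto intro: derivate_above_add simp: field_simps)
qed

lemma LP_compact_diff:
  assumes "LP_compact f p q I" "LP_compact g p q J"
  shows "LP_compact (\<lambda>x. f x - g x) p q (I - J)"
  using assms LP_upper_bound_add[of f p q I "\<lambda>x. - g x" "- J"] LP_upper_bound_add[of "\<lambda>x. - f x" p q "- I" g J]
  by (simp add: LP_compact_def)

lemma LP_upper_bound_opposite:
  assumes "p \<le> q" "LP_upper_bound f p q I" "LP_upper_bound (\<lambda>x. - f x) p q J"
  shows "0 \<le> I + J"
proof (rule field_le_epsilon)
  fix e :: real assume "0 < e"
  then obtain U W where "derivate_above f U p q" "U q - U p \<le> I + e / 2"
      "derivate_above (\<lambda>x. - f x) W p q" "W q - W p \<le> J + e / 2"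
    using assms unfolding LP_upper_bound_def by (meson half_gt_zero)
  with mono_onD[OF derivate_above_opposite_mono[of f U p q W], of p q] assms(1)
  show "0 \<le> I + J + e" by (auto simp: field_simps)
qed

lemma LP_compact_unique:
  assumes "LP_compact f p q I" "LP_compact f p q J"
  shows "I = J"
  using assms LP_upper_bound_opposite[of p q f I "- J"] LP_upper_bound_opposite[of p q f J "- I"]
  by (auto simp: LP_compact_def)

lemma LP_compact_refl: "LP_compact f p p 0"
proof -
  have "derivate_above g (\<lambda>x. 0) p p" for g
    by (auto simp: derivate_above_def side_within_def)
  then show ?thesis
    by (force simp: LP_compact_def LP_upper_bound_def)
qed

text \<open>
  Major functions on adjacent intervals, glued at the common endpoint, form a major function:
  at each point and on each side, a short neighbourhood meets only one of the two pieces.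
\<close>
lemma LP_upper_bound_combine:
  assumes pqr: "p \<le> q" "q \<le> r" and "LP_upper_bound f p q I" "LP_upper_bound f q r J"
  shows "LP_upper_bound f p r (I + J)"
  unfolding LP_upper_bound_def
proof (intro allI impI)
  fix e :: real assume "0 < e"
  then obtain U W where U: "derivate_above f U p q" "U q - U p \<le> I + e / 2"
    and W: "derivate_above f W q r" "W r - W q \<le> J + e / 2"
    using assms unfolding LP_upper_bound_def by (meson half_gt_zero)
  define G where "G x = (if x \<le> q then U x else W x - W q + U q)" for x
  have GW: "G x = W x - W q + U q" if "q \<le> x" for x
    using that by (auto simp: G_def)
  have "continuous_on ({p..q} \<union> {q..r}) G"
    unfolding G_def
    by (rule continuous_on_cases) (auto intro!: continuous_intros derivate_aboveD(2)[OF U(1)] derivate_aboveD(2)[OF W(1)])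
  then have cont: "continuous_on {p..r} G"
    using pqr by (simp add: ivl_disj_un_two_touch)
  have "derivate_above f G p r"
  proof (rule derivate_aboveI[OF cont])
    fix x \<sigma> \<delta> assume s: "side_within p r x \<sigma> \<delta>"
    show "\<exists>\<eta>>0. \<eta> \<le> \<delta> \<and> laplace_ge \<eta> (increment G x \<sigma>) (f x)"
    proof (cases "x < q \<or> x = q \<and> \<sigma> = - 1")
      case True
      define \<eta> where "\<eta> = (if x < q then min \<delta> (q - x) else \<delta>)"
      have \<eta>: "0 < \<eta>" "\<eta> \<le> \<delta>" and s': "side_within p q x \<sigma> \<eta>"
        using s True pqr by (auto simp: side_within_def \<eta>_def min_def)
      have "laplace_ge \<eta> (increment G x \<sigma>) (f x) \<longleftrightarrow> laplace_ge \<eta> (increment U x \<sigma>) (f x)"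
        by (rule laplace_ge_cong)
           (use side_withinD[OF s'] s' in \<open>auto simp: increment_def G_def side_within_def\<close>)
      then show ?thesis
        using \<eta> derivate_aboveD(1)[OF U(1) s'] by blast
    next
      case False
      define \<eta> where "\<eta> = (if q < x then min \<delta> (x - q) else \<delta>)"
      have \<eta>: "0 < \<eta>" "\<eta> \<le> \<delta>" and s': "side_within q r x \<sigma> \<eta>"
        using s False pqr by (auto simp: side_within_def \<eta>_def min_def)
      have "laplace_ge \<eta> (increment G x \<sigma>) (f x) \<longleftrightarrow> laplace_ge \<eta> (increment W x \<sigma>) (f x)"
        by (rule laplace_ge_cong)
           (use side_withinD[OF s'] s' in \<open>auto simp: increment_def GW side_within_def\<close>)
      then show ?thesis
        using \<eta> derivate_aboveD(1)[OF W(1) s'] by blast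
    qed
  qed
  moreover have "G r - G p \<le> I + J + e"
    using U(2) W(2) pqr GW[of r] by (simp add: G_def[of p] field_simps)
  ultimately show "\<exists>U. derivate_above f U p r \<and> U r - U p \<le> I + J + e"
    by blast
qed

lemma LP_compact_combine:
  assumes "LP_compact f p q I" "LP_compact f q r J"
  shows "LP_compact f p r (I + J)"
  using assms LP_upper_bound_combine[of p q r f I J] LP_upper_bound_combine[of p q r "\<lambda>x. - f x" "- I" "- J"]
  by (auto simp: LP_compact_def)

text \<open>
  \<open>\<Phi>\<close> plays the role of an indefinite integral; the error \<open>U - \<Phi>\<close> is monotone and has small total
  increase. Monotonicity is what allows restriction to subintervals and, later, differentiation.
\<close>
definition major_approximable :: "(real \<Rightarrow> real) \<Rightarrow> (real \<Rightarrow> real) \<Rightarrow> real \<Rightarrow> real \<Rightarrow> bool" where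
  "major_approximable f \<Phi> p q \<longleftrightarrow> (\<forall>e>0. \<exists>U. derivate_above f U p q \<and>
     mono_on {p..q} (\<lambda>x. U x - \<Phi> x) \<and> (U q - \<Phi> q) - (U p - \<Phi> p) \<le> e)"

lemma major_approximable_imp_upper_bound:
  assumes "major_approximable f \<Phi> p q" "p \<le> u" "u \<le> v" "v \<le> q"
  shows "LP_upper_bound f u v (\<Phi> v - \<Phi> u)"
  unfolding LP_upper_bound_def
proof (intro allI impI)
  fix e :: real assume "0 < e"
  then obtain U where U: "derivate_above f U p q" "mono_on {p..q} (\<lambda>x. U x - \<Phi> x)"
      "(U q - \<Phi> q) - (U p - \<Phi> p) \<le> e"
    using assms(1) unfolding major_approximable_def by blast
  have "U v - U u \<le> \<Phi> v - \<Phi> u + e"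
    using mono_onD[OF U(2), of v q] mono_onD[OF U(2), of p u] U(3) assms(2-) by auto
  moreover have "derivate_above f U u v"
    using derivate_above_subinterval[OF U(1)] assms(2-) by auto
  ultimately show "\<exists>U. derivate_above f U u v \<and> U v - U u \<le> \<Phi> v - \<Phi> u + e"
    by blast
qed

lemma derivate_above_shift:
  assumes "derivate_above f U p q"
  shows "derivate_above f (\<lambda>x. U x - c) p q"
  using assms by (auto simp: derivate_above_def increment_def[abs_def] intro!: continuous_intros)

text \<open>
  Existence and continuity of the indefinite integral. Major functions \<open>U n\<close> and negated minor
  functions \<open>V n\<close> with \<open>U n + V n\<close> small squeeze a function \<open>\<Phi>\<close>, which is therefore their uniform
  limit. Letting \<open>m\<close> tend to infinity in the monotone functions \<open>U n + V m\<close> shows that \<open>U n - \<Phi>\<close>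
  is monotone.
\<close>
lemma LP_compact_primitive:
  assumes I: "LP_compact f p q I"
  obtains \<Phi> where "continuous_on {p..q} \<Phi>" "major_approximable f \<Phi> p q"
    "major_approximable (\<lambda>x. - f x) (\<lambda>x. - \<Phi> x) p q" "\<Phi> p = 0" "\<Phi> q = I"
proof -
  have pq: "p \<le> q" using I by (simp add: LP_compact_def)
  define e where "e n = inverse (real (Suc n)) / 2" for n
  have e0: "0 < e n" for n by (simp add: e_def)
  have e_lim: "(\<lambda>n. 2 * e n) \<longlonglongrightarrow> 0"
    using LIMSEQ_inverse_real_of_nat by (simp add: e_def)
  have "\<exists>U. derivate_above f U p q \<and> U p = 0 \<and> U q \<le> I + e n" for n
  proof -
    obtain U where "derivate_above f U p q" "U q - U p \<le> I + e n"
      using I e0[of n] unfolding LP_compact_def LP_upper_bound_def by blast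
    then show ?thesis
      using derivate_above_shift[of f U p q "U p"] by (intro exI[of _ "\<lambda>x. U x - U p"]) auto
  qed
  then obtain U where U: "\<And>n. derivate_above f (U n) p q" "\<And>n. U n p = 0" "\<And>n. U n q \<le> I + e n"
    by metis
  have "\<exists>V. derivate_above (\<lambda>x. - f x) V p q \<and> V p = 0 \<and> V q \<le> - I + e n" for n
  proof -
    obtain V where "derivate_above (\<lambda>x. - f x) V p q" "V q - V p \<le> - I + e n"
      using I e0[of n] unfolding LP_compact_def LP_upper_bound_def by blast
    then show ?thesis
      using derivate_above_shift[of "\<lambda>x. - f x" V p q "V p"] by (intro exI[of _ "\<lambda>x. V x - V p"]) auto
  qed
  then obtain V where V: "\<And>n. derivate_above (\<lambda>x. - f x) (V n) p q" "\<And>n. V n p = 0" "\<And>n. V n q \<le> - I + e n"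
    by metis
  have mono: "mono_on {p..q} (\<lambda>x. U n x + V m x)" for n m
    by (rule derivate_above_opposite_mono[OF U(1) V(1)])
  have sum_ge: "0 \<le> U n x + V m x" if "x \<in> {p..q}" for n m x
    using mono_onD[OF mono[of n m], of p x] that U(2) V(2) by auto
  have sum_le: "U n x + V n x \<le> 2 * e n" if "x \<in> {p..q}" for n x
    using mono_onD[OF mono[of n n], of x q] that U(3)[of n] V(3)[of n] by auto
  \<comment> \<open>Every \<open>- V m\<close> lies below every \<open>U n\<close>, so the infimum lies between them.\<close>
  define \<Phi> where "\<Phi> x = (INF n. U n x)" for x
  have bdd: "bdd_below (range (\<lambda>n. U n x))" if x: "x \<in> {p..q}" for x
  proof (rule bdd_belowI)
    fix y assume "y \<in> range (\<lambda>n. U n x)"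
    then obtain n where "y = U n x" by blast
    then show "- V 0 x \<le> y"
      using sum_ge[OF x, of n 0] by linarith
  qed
  have \<Phi>_le: "\<Phi> x \<le> U n x" if "x \<in> {p..q}" for n x
    unfolding \<Phi>_def by (intro cINF_lower bdd that UNIV_I)
  have \<Phi>_ge: "- V n x \<le> \<Phi> x" if "x \<in> {p..q}" for n x
    unfolding \<Phi>_def
  proof (rule cINF_greatest)
    fix m show "- V n x \<le> U m x"
      using sum_ge[OF that, of m n] by linarith
  qed simp
  have U_close: "dist (U n x) (\<Phi> x) \<le> 2 * e n" "dist (V n x) (- \<Phi> x) \<le> 2 * e n" if "x \<in> {p..q}" for n x
    using \<Phi>_le[OF that, of n] \<Phi>_ge[OF that, of n] sum_le[OF that, of n] by (auto simp: dist_real_def)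
  have U_lim: "(\<lambda>n. U n x) \<longlonglongrightarrow> \<Phi> x" and V_lim: "(\<lambda>n. V n x) \<longlonglongrightarrow> - \<Phi> x" if "x \<in> {p..q}" for x
    by (rule metric_tendsto_imp_tendsto[OF e_lim]; use U_close[OF that] e0 in \<open>simp add: order_less_imp_le\<close>)+
  show thesis
  proof
    have "uniform_limit {p..q} U \<Phi> sequentially"
    proof (rule uniform_limitI)
      fix d :: real assume "0 < d"
      have "\<forall>\<^sub>F n in sequentially. 2 * e n < d"
        by (rule order_tendstoD(2)[OF e_lim \<open>0 < d\<close>])
      then show "\<forall>\<^sub>F n in sequentially. \<forall>x\<in>{p..q}. dist (U n x) (\<Phi> x) < d"
        by (rule eventually_mono) (blast intro: le_less_trans[OF U_close(1)])
    qed
    then show "continuous_on {p..q} \<Phi>"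
      by (rule uniform_limit_theorem[rotated])
         (auto intro: always_eventually derivate_aboveD(2)[OF U(1)])
    have ends: "p \<in> {p..q}" "q \<in> {p..q}" using pq by auto
    show \<Phi>p: "\<Phi> p = 0"
      using LIMSEQ_unique[OF U_lim[OF ends(1)]] U(2) by simp
    have e_half: "(\<lambda>n. I + e n) \<longlonglongrightarrow> I" "(\<lambda>n. - I + e n) \<longlonglongrightarrow> - I"
      using tendsto_add[OF tendsto_const[of I] tendsto_mult_right[OF e_lim, of "1/2"]]
        tendsto_add[OF tendsto_const[of "- I"] tendsto_mult_right[OF e_lim, of "1/2"]] by simp_all
    have "\<Phi> q \<le> I"
      by (rule LIMSEQ_le[OF U_lim[OF ends(2)] e_half(1)]) (use U(3) in blast)
    moreover have "- \<Phi> q \<le> - I"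
      by (rule LIMSEQ_le[OF V_lim[OF ends(2)] e_half(2)]) (use V(3) in blast)
    ultimately show "\<Phi> q = I" by simp
    show "major_approximable f \<Phi> p q"
      unfolding major_approximable_def
    proof (intro allI impI)
      fix d :: real assume "0 < d"
      then obtain n where n: "2 * e n < d"
        using order_tendstoD(2)[OF e_lim] eventually_happens by force
      have "mono_on {p..q} (\<lambda>x. U n x - \<Phi> x)"
      proof (rule mono_onI)
        fix x y assume xy: "x \<in> {p..q}" "y \<in> {p..q}" "x \<le> y"
        have "U n x + - \<Phi> x \<le> U n y + - \<Phi> y"
          by (rule LIMSEQ_le[OF tendsto_add[OF tendsto_const V_lim[OF xy(1)]] tendsto_add[OF tendsto_const V_lim[OF xy(2)]]])
             (use mono_onD[OF mono xy] in auto)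
        then show "U n x - \<Phi> x \<le> U n y - \<Phi> y" by simp
      qed
      moreover have "(U n q - \<Phi> q) - (U n p - \<Phi> p) \<le> d"
        using U_close(1)[OF ends(2), of n] n \<Phi>p U(2)[of n] by (auto simp: dist_real_def)
      ultimately show "\<exists>U. derivate_above f U p q \<and> mono_on {p..q} (\<lambda>x. U x - \<Phi> x) \<and> (U q - \<Phi> q) - (U p - \<Phi> p) \<le> d"
        using U(1) by blast
    qed
    show "major_approximable (\<lambda>x. - f x) (\<lambda>x. - \<Phi> x) p q"
      unfolding major_approximable_def
    proof (intro allI impI)
      fix d :: real assume "0 < d"
      then obtain n where n: "2 * e n < d"
        using order_tendstoD(2)[OF e_lim] eventually_happens by force
      have "mono_on {p..q} (\<lambda>x. V n x - - \<Phi> x)"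
      proof (rule mono_onI)
        fix x y assume xy: "x \<in> {p..q}" "y \<in> {p..q}" "x \<le> y"
        have "\<Phi> x + V n x \<le> \<Phi> y + V n y"
          by (rule LIMSEQ_le[OF tendsto_add[OF U_lim[OF xy(1)] tendsto_const] tendsto_add[OF U_lim[OF xy(2)] tendsto_const]])
             (use mono_onD[OF mono xy] in auto)
        then show "V n x - - \<Phi> x \<le> V n y - - \<Phi> y" by simp
      qed
      moreover have "(V n q - - \<Phi> q) - (V n p - - \<Phi> p) \<le> d"
        using U_close(2)[OF ends(2), of n] n \<Phi>p V(2)[of n] by (auto simp: dist_real_def)
      ultimately show "\<exists>U. derivate_above (\<lambda>x. - f x) U p q \<and> mono_on {p..q} (\<lambda>x. U x - - \<Phi> x) \<and> (U q - - \<Phi> q) - (U p - - \<Phi> p) \<le> d"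
        using V(1) by blast
    qed
  qed
qed

lemma LP_compact_subinterval:
  assumes "major_approximable f \<Phi> p q" "major_approximable (\<lambda>x. - f x) (\<lambda>x. - \<Phi> x) p q"
    and "p \<le> u" "u \<le> v" "v \<le> q"
  shows "LP_compact f u v (\<Phi> v - \<Phi> u)"
  using major_approximable_imp_upper_bound[OF assms(1,3-)] major_approximable_imp_upper_bound[OF assms(2,3-)] assms(4)
  by (simp add: LP_compact_def)

lemma LP_compact_diff_left:
  assumes "LP_compact f p v I" "LP_compact f p u J" "u \<le> v"
  shows "LP_compact f u v (I - J)"
proof -
  obtain \<Phi> where \<Phi>: "major_approximable f \<Phi> p v" "major_approximable (\<lambda>x. - f x) (\<lambda>x. - \<Phi> x) p v" "\<Phi> p = 0" "\<Phi> v = I"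
    using LP_compact_primitive[OF assms(1)] by blast
  have pu: "p \<le> u" using assms(2) by (simp add: LP_compact_def)
  have "LP_compact f p u (\<Phi> u - \<Phi> p)"
    by (rule LP_compact_subinterval[OF \<Phi>(1,2)]) (use pu assms(3) in auto)
  from LP_compact_unique[OF assms(2) this] have "J = \<Phi> u"
    using \<Phi>(3) by simp
  moreover have "LP_compact f u v (\<Phi> v - \<Phi> u)"
    by (rule LP_compact_subinterval[OF \<Phi>(1,2)]) (use pu assms(3) in auto)
  ultimately show ?thesis
    using \<Phi>(4) by simp
qed

lemma LP_compact_diff_right:
  assumes "LP_compact f u q I" "LP_compact f v q J" "u \<le> v"
  shows "LP_compact f u v (I - J)"
proof -
  obtain \<Phi> where \<Phi>: "major_approximable f \<Phi> u q" "major_approximable (\<lambda>x. - f x) (\<lambda>x. - \<Phi> x) u q" "\<Phi> u = 0" "\<Phi> q = I"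
    using LP_compact_primitive[OF assms(1)] by blast
  have vq: "v \<le> q" using assms(2) by (simp add: LP_compact_def)
  have "LP_compact f v q (\<Phi> q - \<Phi> v)"
    by (rule LP_compact_subinterval[OF \<Phi>(1,2)]) (use vq assms(3) in auto)
  from LP_compact_unique[OF assms(2) this] have "I - J = \<Phi> v - \<Phi> u"
    using \<Phi>(3,4) by simp
  moreover have "LP_compact f u v (\<Phi> v - \<Phi> u)"
    by (rule LP_compact_subinterval[OF \<Phi>(1,2)]) (use vq assms(3) in auto)
  ultimately show ?thesis by simp
qed

text \<open>
  By uniqueness of the integral, \<open>\<phi>\<close> differs only by a constant from the function that
  \<open>LP_compact_primitive\<close> provides.
\<close>
lemma LP_compact_family_primitive:
  assumes fam: "\<And>u v. p \<le> u \<Longrightarrow> u \<le> v \<Longrightarrow> v \<le> q \<Longrightarrow> LP_compact f u v (\<phi> v - \<phi> u)" and pq: "p \<le> q"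
  shows "continuous_on {p..q} \<phi>" "major_approximable f \<phi> p q"
    "major_approximable (\<lambda>x. - f x) (\<lambda>x. - \<phi> x) p q"
proof -
  obtain \<Phi> where \<Phi>: "continuous_on {p..q} \<Phi>" "major_approximable f \<Phi> p q"
    "major_approximable (\<lambda>x. - f x) (\<lambda>x. - \<Phi> x) p q" "\<Phi> p = 0"
    using LP_compact_primitive[OF fam[of p q]] pq by blast
  define c where "c = \<phi> p"
  have eq: "\<phi> x = \<Phi> x + c" if "x \<in> {p..q}" for x
    using LP_compact_unique[OF fam[of p x] LP_compact_subinterval[OF \<Phi>(2,3), of p x]] that \<Phi>(4) by (auto simp: c_def)
  show "continuous_on {p..q} \<phi>"
    using \<Phi>(1) by (subst continuous_on_cong[OF refl eq]) (auto intro!: continuous_intros)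
  have mono: "mono_on {p..q} (\<lambda>x. U x - \<phi> x) \<longleftrightarrow> mono_on {p..q} (\<lambda>x. U x - \<Phi> x)"
    "mono_on {p..q} (\<lambda>x. U x - - \<phi> x) \<longleftrightarrow> mono_on {p..q} (\<lambda>x. U x - - \<Phi> x)" for U
    by (auto simp: mono_on_def eq)
  show "major_approximable f \<phi> p q"
    using \<Phi>(2) pq unfolding major_approximable_def mono by (simp add: eq algebra_simps)
  show "major_approximable (\<lambda>x. - f x) (\<lambda>x. - \<phi> x) p q"
    using \<Phi>(3) pq unfolding major_approximable_def mono by (simp add: eq algebra_simps)
qed

section \<open>Indefinite integrals on extended real intervals\<close>

lemma has_LP_integral_compact_iff:
  assumes "p \<le> q"
  shows "has_LP_integral f (ereal p) (ereal q) I \<longleftrightarrow> LP_compact f p q I"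
proof
  assume "has_LP_integral f (ereal p) (ereal q) I"
  then show "LP_compact f p q I"
    using assms by cases (auto simp: LP_compact_iff[of f p q] LP_compact_refl)
next
  assume "LP_compact f p q I"
  then show "has_LP_integral f (ereal p) (ereal q) I"
    by (auto simp: LP_compact_iff intro: has_LP_integral.compact)
qed

text \<open>
  The four kinds of intervals (compact, two half-lines, the whole line) are unified by an
  indefinite integral on the extended interval: continuity at \<open>\<plusminus>\<infinity>\<close> expresses the convergence of
  the improper integral.
\<close>
definition LP_indefinite :: "(real \<Rightarrow> real) \<Rightarrow> ereal \<Rightarrow> ereal \<Rightarrow> (ereal \<Rightarrow> real) \<Rightarrow> bool" where
  "LP_indefinite f a b \<Phi> \<longleftrightarrow> continuous_on {a..b} \<Phi> \<and>
     (\<forall>u v. u \<le> v \<longrightarrow> a \<le> ereal u \<longrightarrow> ereal v \<le> b \<longrightarrow> LP_compact f u v (\<Phi> (ereal v) - \<Phi> (ereal u)))"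

lemma LP_indefiniteD:
  assumes "LP_indefinite f a b \<Phi>"
  shows "continuous_on {a..b} \<Phi>"
    and "u \<le> v \<Longrightarrow> a \<le> ereal u \<Longrightarrow> ereal v \<le> b \<Longrightarrow> LP_compact f u v (\<Phi> (ereal v) - \<Phi> (ereal u))"
  using assms by (auto simp: LP_indefinite_def)

lemma at_MInf_eq: "at (-\<infinity>::ereal) = filtermap ereal at_bot"
proof -
  have "at (-\<infinity>::ereal) = at_right (-\<infinity>)"
    unfolding at_within_def by (rule arg_cong[where f="\<lambda>S. inf _ (principal S)"]) auto
  then show ?thesis by (simp add: at_right_MInf)
qed

lemma continuous_on_real_to_ereal:
  assumes "continuous_on {ereal p..ereal q} \<Phi>"
  shows "continuous_on {p..q} (\<lambda>x. \<Phi> (ereal x))"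
  by (rule continuous_on_compose2[OF assms]) (auto intro!: continuous_intros)

text \<open>
  Near a real point the extended interval looks like a compact real interval, and the punctured
  neighbourhoods of \<open>\<infinity>\<close> and \<open>-\<infinity>\<close> are the images of those in \<open>at_top\<close> and \<open>at_bot\<close>.
\<close>
lemma continuous_on_ereal_interval:
  fixes \<Phi> :: "ereal \<Rightarrow> real"
  assumes real: "\<And>p q. p \<le> q \<Longrightarrow> a \<le> ereal p \<Longrightarrow> ereal q \<le> b \<Longrightarrow> continuous_on {p..q} (\<lambda>x. \<Phi> (ereal x))"
    and top: "b = \<infinity> \<Longrightarrow> ((\<lambda>x. \<Phi> (ereal x)) \<longlongrightarrow> \<Phi> \<infinity>) at_top"
    and bot: "a = -\<infinity> \<Longrightarrow> ((\<lambda>x. \<Phi> (ereal x)) \<longlongrightarrow> \<Phi> (-\<infinity>)) at_bot"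
  shows "continuous_on {a..b} \<Phi>"
  unfolding continuous_on_def
proof
  fix x assume x: "x \<in> {a..b}"
  show "(\<Phi> \<longlongrightarrow> \<Phi> x) (at x within {a..b})"
  proof (cases x)
    case (real r)
    \<comment> \<open>\<open>{p..q}\<close> is the part of the interval within distance \<open>1\<close> of \<open>r\<close>.\<close>
    define p where "p = (if a = -\<infinity> then r - 1 else max (r - 1) (real_of_ereal a))"
    define q where "q = (if b = \<infinity> then r + 1 else min (r + 1) (real_of_ereal b))"
    have a: "a = -\<infinity> \<or> (\<exists>a'. a = ereal a' \<and> a' \<le> r)"
      using x real by (cases a) auto
    have b: "b = \<infinity> \<or> (\<exists>b'. b = ereal b' \<and> r \<le> b')"
      using x real by (cases b) auto
    have pq: "p \<le> r" "r \<le> q" "a \<le> ereal p" "ereal q \<le> b"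
      using a b by (auto simp: p_def q_def)
    have "at r within {y. a \<le> ereal y \<and> ereal y \<le> b} = at r within {p..q}"
      by (rule at_within_nhd[of _ "{r - 1<..<r + 1}"]) (use a b in \<open>auto simp: p_def q_def split: if_splits\<close>)
    moreover have "((\<lambda>x. \<Phi> (ereal x)) \<longlongrightarrow> \<Phi> (ereal r)) (at r within {p..q})"
      using assms(1)[of p q] pq by (auto simp: continuous_on_def)
    ultimately have "((\<lambda>x. \<Phi> (ereal x)) \<longlongrightarrow> \<Phi> (ereal r)) (at r within {y. a \<le> ereal y \<and> ereal y \<le> b})"
      by simp
    then show ?thesis
      by (simp add: real tendsto_def eventually_at_filter nhds_ereal eventually_filtermap)
  next
    case PInf
    then have "(\<Phi> \<longlongrightarrow> \<Phi> x) (at x)"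
      using top x by (simp add: at_infty_ereal_eq_at_top tendsto_compose_filtermap[symmetric] comp_def)
    then show ?thesis by (rule tendsto_within_subset) simp
  next
    case MInf
    then have "(\<Phi> \<longlongrightarrow> \<Phi> x) (at x)"
      using bot x by (simp add: at_MInf_eq tendsto_compose_filtermap[symmetric] comp_def)
    then show ?thesis by (rule tendsto_within_subset) simp
  qed
qed

lemma continuous_on_ereal_at_top:
  fixes \<Phi> :: "ereal \<Rightarrow> real"
  assumes "continuous_on {a..\<infinity>} \<Phi>" "a < \<infinity>"
  shows "((\<lambda>x. \<Phi> (ereal x)) \<longlongrightarrow> \<Phi> \<infinity>) at_top"
proof (rule continuous_on_tendsto_compose[OF assms(1)])
  show "(ereal \<longlongrightarrow> \<infinity>) at_top"
    by (simp add: tendsto_PInfty_eq_at_top filterlim_ident)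
  obtain r where "a < ereal r"
    using ereal_dense2[OF assms(2)] by blast
  then show "\<forall>\<^sub>F x in at_top. ereal x \<in> {a..\<infinity>}"
    by (intro eventually_at_top_linorderI[of r]) (auto intro: order_trans[of a "ereal r"])
qed simp

lemma continuous_on_ereal_at_bot:
  fixes \<Phi> :: "ereal \<Rightarrow> real"
  assumes "continuous_on {-\<infinity>..b} \<Phi>" "-\<infinity> < b"
  shows "((\<lambda>x. \<Phi> (ereal x)) \<longlongrightarrow> \<Phi> (-\<infinity>)) at_bot"
proof (rule continuous_on_tendsto_compose[OF assms(1)])
  show "(ereal \<longlongrightarrow> -\<infinity>) at_bot"
    using ereal_tendsto_simps2(3)[of "\<lambda>x. x" at_bot] by (simp add: filterlim_ident comp_def)
  obtain r where "ereal r < b"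
    using ereal_dense2[OF assms(2)] by blast
  then show "\<forall>\<^sub>F x in at_bot. ereal x \<in> {-\<infinity>..b}"
    unfolding eventually_at_bot_linorder
    by (intro exI[of _ r]) (auto intro: order_trans[of _ "ereal r" b])
qed simp

text \<open>
  Continuity at the real points comes for free from \<open>LP_compact_family_primitive\<close>.
\<close>
lemma LP_indefiniteI:
  assumes fam: "\<And>u v. u \<le> v \<Longrightarrow> a \<le> ereal u \<Longrightarrow> ereal v \<le> b \<Longrightarrow> LP_compact f u v (\<Phi> (ereal v) - \<Phi> (ereal u))"
    and top: "b = \<infinity> \<Longrightarrow> ((\<lambda>x. \<Phi> (ereal x)) \<longlongrightarrow> \<Phi> \<infinity>) at_top"
    and bot: "a = -\<infinity> \<Longrightarrow> ((\<lambda>x. \<Phi> (ereal x)) \<longlongrightarrow> \<Phi> (-\<infinity>)) at_bot"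
  shows "LP_indefinite f a b \<Phi>"
proof -
  have "continuous_on {p..q} (\<lambda>x. \<Phi> (ereal x))" if "p \<le> q" "a \<le> ereal p" "ereal q \<le> b" for p q
  proof (rule LP_compact_family_primitive(1)[OF _ that(1)])
    fix u v assume "p \<le> u" "u \<le> v" "v \<le> q"
    then show "LP_compact f u v (\<Phi> (ereal v) - \<Phi> (ereal u))"
      using that by (intro fam) (auto intro: order_trans[of a "ereal p"] order_trans[of _ "ereal q" b])
  qed
  then have "continuous_on {a..b} \<Phi>"
    using top bot by (intro continuous_on_ereal_interval) auto
  then show ?thesis
    using fam by (simp add: LP_indefinite_def)
qed

lemma LP_indefinite_subinterval:
  assumes "LP_indefinite f a b \<Phi>" "a \<le> u" "v \<le> b"
  shows "LP_indefinite f u v \<Phi>"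
  using assms continuous_on_subset[of "{a..b}" \<Phi> "{u..v}"] unfolding LP_indefinite_def
  by (auto intro: order_trans)

lemma LP_indefinite_imp_has_integral:
  assumes \<Phi>: "LP_indefinite f a b \<Phi>" and ab: "a < b"
  shows "has_LP_integral f a b (\<Phi> b - \<Phi> a)"
proof -
  have compact: "has_LP_integral f (ereal u) (ereal v) (\<Phi> (ereal v) - \<Phi> (ereal u))"
    if "u \<le> v" "a \<le> ereal u" "ereal v \<le> b" for u v
    using that LP_indefiniteD(2)[OF \<Phi>] by (simp add: has_LP_integral_compact_iff)
  have right: "has_LP_integral f (ereal u) \<infinity> (\<Phi> \<infinity> - \<Phi> (ereal u))" if "b = \<infinity>" "a \<le> ereal u" for u
    using that compact LP_indefiniteD(1)[OF \<Phi>] ab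
    by (intro has_LP_integral.to_PInf[of _ _ "\<lambda>c. \<Phi> (ereal c) - \<Phi> (ereal u)"] tendsto_intros
        continuous_on_ereal_at_top) auto
  have left: "has_LP_integral f (-\<infinity>) (ereal v) (\<Phi> (ereal v) - \<Phi> (-\<infinity>))" if "a = -\<infinity>" "ereal v \<le> b" for v
    using that compact LP_indefiniteD(1)[OF \<Phi>] ab
    by (intro has_LP_integral.from_MInf[of _ _ "\<lambda>c. \<Phi> (ereal v) - \<Phi> (ereal c)"] tendsto_intros
        continuous_on_ereal_at_bot) auto
  show ?thesis
  proof (cases a)
    case (real p)
    show ?thesis
      using real ab compact right by (cases b) auto
  next
    case MInf
    show ?thesis
    proof (cases b)
      case PInf
      show ?thesis
        using has_LP_integral.whole_line[OF left[of 0] right[of 0]] MInf PInf by simp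
    qed (use MInf ab left in auto)
  qed (use ab in auto)
qed

lemma has_integral_imp_LP_indefinite_PInf:
  assumes "has_LP_integral f (ereal p) \<infinity> I"
  obtains \<Phi> where "LP_indefinite f (ereal p) \<infinity> \<Phi>" "I = \<Phi> \<infinity> - \<Phi> (ereal p)"
proof -
  from assms obtain J where J: "\<And>c. p \<le> c \<Longrightarrow> has_LP_integral f (ereal p) (ereal c) (J c)" and lim: "(J \<longlongrightarrow> I) at_top"
    by cases auto
  have comp: "LP_compact f p c (J c)" if "p \<le> c" for c
    using J[OF that] that by (simp add: has_LP_integral_compact_iff)
  have J0: "J p = 0"
    using LP_compact_unique[OF comp[of p] LP_compact_refl] by simp
  define \<Phi> where "\<Phi> e = (if e = \<infinity> then I else J (real_of_ereal e))" for e
  have "LP_indefinite f (ereal p) \<infinity> \<Phi>"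
  proof (rule LP_indefiniteI)
    fix u v assume "u \<le> v" "ereal p \<le> ereal u"
    then show "LP_compact f u v (\<Phi> (ereal v) - \<Phi> (ereal u))"
      using LP_compact_diff_left[OF comp[of v] comp[of u]] by (simp add: \<Phi>_def)
  qed (use lim in \<open>simp_all add: \<Phi>_def\<close>)
  then show thesis
    by (rule that) (simp add: \<Phi>_def J0)
qed

lemma has_integral_imp_LP_indefinite_MInf:
  assumes "has_LP_integral f (-\<infinity>) (ereal q) I"
  obtains \<Phi> where "LP_indefinite f (-\<infinity>) (ereal q) \<Phi>" "I = \<Phi> (ereal q) - \<Phi> (-\<infinity>)"
proof -
  from assms obtain J where J: "\<And>c. c \<le> q \<Longrightarrow> has_LP_integral f (ereal c) (ereal q) (J c)" and lim: "(J \<longlongrightarrow> I) at_bot"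
    by cases auto
  have comp: "LP_compact f c q (J c)" if "c \<le> q" for c
    using J[OF that] that by (simp add: has_LP_integral_compact_iff)
  have J0: "J q = 0"
    using LP_compact_unique[OF comp[of q] LP_compact_refl] by simp
  define \<Phi> where "\<Phi> e = (if e = -\<infinity> then - I else - J (real_of_ereal e))" for e
  have "LP_indefinite f (-\<infinity>) (ereal q) \<Phi>"
  proof (rule LP_indefiniteI)
    fix u v assume "u \<le> v" "ereal v \<le> ereal q"
    then show "LP_compact f u v (\<Phi> (ereal v) - \<Phi> (ereal u))"
      using LP_compact_diff_right[OF comp[of u] comp[of v]] by (simp add: \<Phi>_def)
  qed (use tendsto_minus[OF lim] in \<open>simp_all add: \<Phi>_def\<close>)
  then show thesis
    by (rule that) (simp add: \<Phi>_def J0)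
qed

text \<open>
  Needed for the integral over the whole line, which is defined by means of a splitting point
  \<open>p\<close>: subintervals that contain \<open>p\<close> are glued from two pieces.
\<close>
lemma LP_indefinite_combine:
  assumes \<Phi>: "LP_indefinite f a (ereal p) \<Phi>" and \<Psi>: "LP_indefinite f (ereal p) b \<Psi>"
    and ap: "a \<le> ereal p" "ereal p \<le> b"
  obtains G where "LP_indefinite f a b G" "G b - G a = (\<Phi> (ereal p) - \<Phi> a) + (\<Psi> b - \<Psi> (ereal p))"
proof -
  define G where "G e = (if e \<le> ereal p then \<Phi> e - \<Phi> (ereal p) else \<Psi> e - \<Psi> (ereal p))" for e
  have G2: "G e = \<Psi> e - \<Psi> (ereal p)" if "ereal p \<le> e" for e
    using that by (auto simp: G_def)
  have left: "LP_compact f u v (G (ereal v) - G (ereal u))" if "u \<le> v" "a \<le> ereal u" "v \<le> p" for u v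
    using LP_indefiniteD(2)[OF \<Phi>, of u v] that by (simp add: G_def)
  have right: "LP_compact f u v (G (ereal v) - G (ereal u))" if "u \<le> v" "p \<le> u" "ereal v \<le> b" for u v
    using LP_indefiniteD(2)[OF \<Psi>, of u v] that by (simp add: G2)
  have "LP_indefinite f a b G"
  proof (rule LP_indefiniteI)
    fix u v assume uv: "u \<le> v" "a \<le> ereal u" "ereal v \<le> b"
    consider "v \<le> p" | "p \<le> u" | "u \<le> p" "p \<le> v" by linarith
    then show "LP_compact f u v (G (ereal v) - G (ereal u))"
    proof cases
      case 3
      then show ?thesis
        using LP_compact_combine[OF left[of u p] right[of p v]] uv by simp
    qed (use uv left right in auto)
  next
    assume b: "b = \<infinity>"
    have "((\<lambda>x. \<Psi> (ereal x) - \<Psi> (ereal p)) \<longlongrightarrow> \<Psi> \<infinity> - \<Psi> (ereal p)) at_top"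
      using LP_indefiniteD(1)[OF \<Psi>] b by (intro tendsto_intros continuous_on_ereal_at_top) auto
    moreover have "\<forall>\<^sub>F x in at_top. \<Psi> (ereal x) - \<Psi> (ereal p) = G (ereal x)"
      using eventually_ge_at_top[of p] by eventually_elim (simp add: G2)
    ultimately show "((\<lambda>x. G (ereal x)) \<longlongrightarrow> G \<infinity>) at_top"
      unfolding G2[of \<infinity>, simplified] by (rule Lim_transform_eventually)
  next
    assume a: "a = -\<infinity>"
    have "((\<lambda>x. \<Phi> (ereal x) - \<Phi> (ereal p)) \<longlongrightarrow> \<Phi> (-\<infinity>) - \<Phi> (ereal p)) at_bot"
      using LP_indefiniteD(1)[OF \<Phi>] a by (intro tendsto_intros continuous_on_ereal_at_bot) auto
    moreover have "\<forall>\<^sub>F x in at_bot. \<Phi> (ereal x) - \<Phi> (ereal p) = G (ereal x)"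
      using eventually_le_at_bot[of p] by eventually_elim (simp add: G_def)
    ultimately show "((\<lambda>x. G (ereal x)) \<longlongrightarrow> G (-\<infinity>)) at_bot"
      by (simp add: G_def[of "-\<infinity>"] Lim_transform_eventually)
  qed
  then show thesis
    by (rule that) (use ap G2[of b] in \<open>simp add: G_def[of a]\<close>)
qed

text \<open>
  From here on, integrals over nondegenerate intervals are handled through their indefinite
  integrals, without distinguishing the kinds of intervals.
\<close>
lemma has_LP_integral_iff_indefinite:
  assumes ab: "a < b"
  shows "has_LP_integral f a b I \<longleftrightarrow> (\<exists>\<Phi>. LP_indefinite f a b \<Phi> \<and> I = \<Phi> b - \<Phi> a)"
proof
  assume I: "has_LP_integral f a b I"
  then show "\<exists>\<Phi>. LP_indefinite f a b \<Phi> \<and> I = \<Phi> b - \<Phi> a"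
  proof cases
    case (compact p q)
    then have "LP_compact f p q I"
      using I by (simp add: has_LP_integral_compact_iff)
    then obtain \<Phi> where \<Phi>: "major_approximable f \<Phi> p q" "major_approximable (\<lambda>x. - f x) (\<lambda>x. - \<Phi> x) p q"
        "\<Phi> p = 0" "\<Phi> q = I"
      by (rule LP_compact_primitive)
    have "LP_indefinite f a b (\<lambda>e. \<Phi> (real_of_ereal e))"
    proof (rule LP_indefiniteI)
      fix u v assume "u \<le> v" "a \<le> ereal u" "ereal v \<le> b"
      then show "LP_compact f u v (\<Phi> (real_of_ereal (ereal v)) - \<Phi> (real_of_ereal (ereal u)))"
        using LP_compact_subinterval[OF \<Phi>(1,2), of u v] compact(1,2) by simp
    qed (use compact(1,2) in simp_all)
    then show ?thesis
      using \<Phi>(3,4) compact(1,2) by (intro exI[of _ "\<lambda>e. \<Phi> (real_of_ereal e)"]) auto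
  next
    case (to_PInf p J)
    with I have "has_LP_integral f (ereal p) \<infinity> I" by simp
    then show ?thesis
      by (rule has_integral_imp_LP_indefinite_PInf) (use to_PInf in auto)
  next
    case (from_MInf q J)
    with I have "has_LP_integral f (-\<infinity>) (ereal q) I" by simp
    then show ?thesis
      by (rule has_integral_imp_LP_indefinite_MInf) (use from_MInf in auto)
  next
    case (whole_line p I1 I2)
    obtain \<Phi> where \<Phi>: "LP_indefinite f (-\<infinity>) (ereal p) \<Phi>" "I1 = \<Phi> (ereal p) - \<Phi> (-\<infinity>)"
      using has_integral_imp_LP_indefinite_MInf[OF whole_line(4)] by blast
    obtain \<Psi> where \<Psi>: "LP_indefinite f (ereal p) \<infinity> \<Psi>" "I2 = \<Psi> \<infinity> - \<Psi> (ereal p)"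
      using has_integral_imp_LP_indefinite_PInf[OF whole_line(5)] by blast
    obtain G where "LP_indefinite f (-\<infinity>) \<infinity> G" "G \<infinity> - G (-\<infinity>) = I1 + I2"
      using LP_indefinite_combine[OF \<Phi>(1) \<Psi>(1)] \<Phi>(2) \<Psi>(2) by auto
    then show ?thesis
      using whole_line by auto
  qed (use ab in auto)
qed (auto intro: LP_indefinite_imp_has_integral[OF _ ab])

lemma has_LP_integral_refl_iff: "has_LP_integral f a a I \<longleftrightarrow> I = 0"
proof
  assume "has_LP_integral f a a I"
  then show "I = 0"
  proof cases
    case (compact p q)
    then have "has_LP_integral f (ereal p) (ereal p) I"
      using has_LP_integral.compact[of p q f I] by simp
    then show ?thesis
      using LP_compact_unique[of f p p I 0] LP_compact_refl[of f p] by (simp add: has_LP_integral_compact_iff)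
  qed auto
qed (auto intro: has_LP_integral.degenerate)

lemma has_LP_integral_reverse_iff:
  assumes "b < a"
  shows "has_LP_integral f a b I \<longleftrightarrow> has_LP_integral f b a (- I)"
proof
  assume "has_LP_integral f a b I"
  then show "has_LP_integral f b a (- I)"
    by cases (use assms in auto)
next
  assume "has_LP_integral f b a (- I)"
  from has_LP_integral.reversed[OF assms this] show "has_LP_integral f a b I" by simp
qed

lemma LP_indefinite_imp_has_integral_between:
  assumes \<Phi>: "LP_indefinite f a b \<Phi>" and uv: "u \<in> {a..b}" "v \<in> {a..b}"
  shows "has_LP_integral f u v (\<Phi> v - \<Phi> u)"
proof -
  have "has_LP_integral f u v (\<Phi> v - \<Phi> u)" if "u < v" "u \<in> {a..b}" "v \<in> {a..b}" for u v
    using that by (intro LP_indefinite_imp_has_integral LP_indefinite_subinterval[OF \<Phi>]) auto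
  note less = this
  consider "u < v" | "u = v" | "v < u" by force
  then show ?thesis
  proof cases
    case 1
    then show ?thesis using less uv by blast
  next
    case 2
    then show ?thesis by (simp add: has_LP_integral_refl_iff)
  next
    case 3
    then show ?thesis using less[OF 3 uv(2,1)] by (simp add: has_LP_integral_reverse_iff[OF 3])
  qed
qed

lemma LP_indefinite_diff:
  assumes "LP_indefinite f a b \<Phi>" "LP_indefinite g a b \<Psi>"
  shows "LP_indefinite (\<lambda>x. f x - g x) a b (\<lambda>x. \<Phi> x - \<Psi> x)"
  unfolding LP_indefinite_def
proof (intro conjI allI impI)
  fix u v assume "u \<le> v" "a \<le> ereal u" "ereal v \<le> b"
  from LP_compact_diff[OF LP_indefiniteD(2)[OF assms(1) this] LP_indefiniteD(2)[OF assms(2) this]]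
  show "LP_compact (\<lambda>x. f x - g x) u v (\<Phi> (ereal v) - \<Psi> (ereal v) - (\<Phi> (ereal u) - \<Psi> (ereal u)))"
    by (simp add: algebra_simps)
qed (use assms in \<open>auto simp: LP_indefinite_def intro!: continuous_intros\<close>)

lemma has_LP_integral_diff:
  assumes "a \<le> b" "has_LP_integral f a b I" "has_LP_integral g a b J"
  shows "has_LP_integral (\<lambda>x. f x - g x) a b (I - J)"
proof (cases "a = b")
  case False
  with assms have ab: "a < b" by simp
  from assms(2) obtain \<Phi> where \<Phi>: "LP_indefinite f a b \<Phi>" "I = \<Phi> b - \<Phi> a"
    using has_LP_integral_iff_indefinite[OF ab] by blast
  from assms(3) obtain \<Psi> where \<Psi>: "LP_indefinite g a b \<Psi>" "J = \<Psi> b - \<Psi> a"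
    using has_LP_integral_iff_indefinite[OF ab] by blast
  have "\<Phi> b - \<Psi> b - (\<Phi> a - \<Psi> a) = I - J"
    by (simp add: \<Phi>(2) \<Psi>(2))
  with LP_indefinite_imp_has_integral[OF LP_indefinite_diff[OF \<Phi>(1) \<Psi>(1)] ab] show ?thesis
    by simp
qed (use assms in \<open>auto simp: has_LP_integral_refl_iff\<close>)

section \<open>Exceptional null sets\<close>

text \<open>
  Cover \<open>N\<close> by open sets \<open>G n\<close> whose measures have sum at most \<open>e\<close>, and let \<open>W\<close> be the sum over \<open>n\<close>
  of the measures of the parts of \<open>G n\<close> to the left of the argument. Near a point of \<open>N\<close> the first
  \<open>k\<close> of the sets contain a common interval, so \<open>W\<close> has slope at least \<open>k\<close> there.
\<close>
lemma null_set_steep_function: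
  fixes p q e :: real
  assumes N: "negligible N" and e: "0 < e" and pq: "p \<le> q"
  obtains W where "continuous_on {p..q} W" "mono_on {p..q} W" "W q - W p \<le> e"
    "\<And>x k. x \<in> N \<Longrightarrow> \<exists>r>0. \<forall>u v. p \<le> u \<longrightarrow> x - r \<le> u \<longrightarrow> u \<le> v \<longrightarrow> v \<le> x + r \<longrightarrow> v \<le> q \<longrightarrow>
       real k * (v - u) \<le> W v - W u"
proof -
  \<comment> \<open>Bounds for the measures of the covering sets, with sum \<open>e\<close>.\<close>
  define M where "M n = e * (1/2) ^ Suc n" for n
  have M0: "0 < M n" for n using e by (simp add: M_def)
  have M_sums: "M sums e"
    using sums_mult[OF power_half_series, of e] by (simp add: M_def[abs_def])
  have "\<exists>G. open G \<and> N \<subseteq> G \<and> G \<in> lmeasurable \<and> measure lebesgue G \<le> M n" for n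
  proof -
    have N': "N \<in> sets lebesgue" "N \<in> null_sets lebesgue"
      using N by (auto simp: negligible_iff_null_sets)
    obtain G where G: "open G" "N \<subseteq> G" "G - N \<in> lmeasurable" "emeasure lebesgue (G - N) < ennreal (M n)"
      using sets_lebesgue_outer_open[OF N'(1) M0[of n]] by blast
    have "emeasure lebesgue G = emeasure lebesgue (G - N)"
      using G(1) N'(2) by (simp add: emeasure_Diff_null_set)
    then have *: "emeasure lebesgue G < ennreal (M n)" "G \<in> sets lebesgue"
      using G by auto
    then have "G \<in> lmeasurable"
      by (intro fmeasurableI) (auto intro: less_trans)
    moreover have "measure lebesgue G \<le> M n"
      using *(1) M0[of n] by (simp add: measure_def enn2real_leI)
    ultimately show ?thesis using G by blast
  qed
  then obtain G where G: "\<And>n. open (G n)" "\<And>n. N \<subseteq> G n" "\<And>n. G n \<in> lmeasurable" "\<And>n. measure lebesgue (G n) \<le> M n"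
    by metis
  have meas: "G n \<inter> {u<..v} \<in> lmeasurable" for n u v
  proof -
    have "G n \<inter> {u<..v} \<in> sets lebesgue" "G n \<inter> {u<..v} \<subseteq> G n"
      using fmeasurableD[OF G(3)] by auto
    then show ?thesis
      by (intro fmeasurableI2[OF G(3)])
  qed
  define w where "w n x = measure lebesgue (G n \<inter> {p<..x})" for n x
  have w_diff: "w n v - w n u = measure lebesgue (G n \<inter> {u<..v})" if "p \<le> u" "u \<le> v" for n u v
  proof -
    have "G n \<inter> {p<..v} = (G n \<inter> {p<..u}) \<union> (G n \<inter> {u<..v})"
      using that by auto
    moreover have "(G n \<inter> {p<..u}) \<inter> (G n \<inter> {u<..v}) = {}"
      by auto
    then have "measure lebesgue ((G n \<inter> {p<..u}) \<union> (G n \<inter> {u<..v})) =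
        measure lebesgue (G n \<inter> {p<..u}) + measure lebesgue (G n \<inter> {u<..v})"
      using measure_Un3[OF meas meas, of n p u n u v] by simp
    ultimately show ?thesis by (simp add: w_def)
  qed
  have w_mono: "0 \<le> w n v - w n u" and w_lip: "w n v - w n u \<le> v - u"
    if "p \<le> u" "u \<le> v" for n u v
  proof -
    show "0 \<le> w n v - w n u" using w_diff[OF that] by simp
    have "measure lebesgue (G n \<inter> {u<..v}) \<le> measure lebesgue (cbox u v)"
      using meas by (intro measure_mono_fmeasurable fmeasurableD lmeasurable_cbox) auto
    then show "w n v - w n u \<le> v - u" using w_diff[OF that] that by simp
  qed
  have w_inside: "w n v - w n u = v - u" if "p \<le> u" "u \<le> v" "{u<..v} \<subseteq> G n" for n u v
  proof -
    have "G n \<inter> {u<..v} = {u<..v}" using that by auto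
    then show ?thesis using w_diff[OF that(1,2)] that(2) by simp
  qed
  have w_bound: "0 \<le> w n x" "w n x \<le> M n" for n x
  proof -
    have "measure lebesgue (G n \<inter> {p<..x}) \<le> measure lebesgue (G n)"
      by (rule measure_mono_fmeasurable) (use G(3) meas in \<open>auto intro: fmeasurableD\<close>)
    then show "w n x \<le> M n" using G(4)[of n] by (simp add: w_def)
  qed (simp add: w_def)
  have w_summable: "summable (\<lambda>n. w n x)" for x
    by (rule summable_comparison_test[OF _ sums_summable[OF M_sums]]) (use w_bound in auto)
  define W where "W x = (\<Sum>n. w n x)" for x
  have W_diff: "W v - W u = (\<Sum>n. w n v - w n u)" for u v
    unfolding W_def by (rule suminf_diff[OF w_summable w_summable])
  have W_partial: "(\<Sum>n<k. w n v - w n u) \<le> W v - W u" if "p \<le> u" "u \<le> v" for k u v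
    unfolding W_diff by (intro sum_le_suminf summable_diff w_summable) (use w_mono[OF that] in auto)
  show thesis
  proof
    have w_cont: "continuous_on {p..q} (w n)" for n
    proof (rule continuous_onI)
      fix x d :: real assume x: "x \<in> {p..q}" and d: "0 < d"
      have "dist (w n y) (w n x) \<le> dist y x" if y: "y \<in> {p..q}" for y
        using w_mono[of x y n] w_lip[of x y n] w_mono[of y x n] w_lip[of y x n] x y
        by (cases "x \<le> y") (auto simp: dist_real_def)
      then show "\<exists>r>0. \<forall>y\<in>{p..q}. dist y x < r \<longrightarrow> dist (w n y) (w n x) \<le> d"
        using d by (intro exI[of _ d]) force
    qed
    have "uniform_limit {p..q} (\<lambda>n x. \<Sum>i<n. w i x) W sequentially"
      unfolding W_def
      by (rule Weierstrass_m_test[OF _ sums_summable[OF M_sums]]) (use w_bound in auto)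
    then show "continuous_on {p..q} W"
      by (rule uniform_limit_theorem[rotated]) (auto intro!: always_eventually continuous_on_sum w_cont)
    show "mono_on {p..q} W"
    proof (rule mono_onI)
      fix u v assume "u \<in> {p..q}" "v \<in> {p..q}" "u \<le> v"
      then show "W u \<le> W v" using W_partial[of u v 0] by simp
    qed
    have "W q - W p \<le> suminf M"
      unfolding W_diff
    proof (rule suminf_le)
      show "w n q - w n p \<le> M n" for n
        using w_bound(2)[of n q] w_bound(1)[of n p] by linarith
    qed (auto intro!: summable_diff w_summable sums_summable[OF M_sums])
    then show "W q - W p \<le> e"
      using M_sums by (simp add: sums_iff)
    fix x k assume x: "x \<in> N"
    have "open (\<Inter>n<k. G n)" "x \<in> (\<Inter>n<k. G n)"
      using G(1,2) x by (auto intro!: open_INT)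
    then obtain r where r: "0 < r" "cball x r \<subseteq> (\<Inter>n<k. G n)"
      using open_contains_cball by metis
    have "real k * (v - u) \<le> W v - W u" if "p \<le> u" "x - r \<le> u" "u \<le> v" "v \<le> x + r" for u v
    proof -
      have "{u<..v} \<subseteq> cball x r"
        using that by (auto simp: dist_real_def)
      then have "w n v - w n u = v - u" if "n < k" for n
        using that r(2) \<open>p \<le> u\<close> \<open>u \<le> v\<close> by (intro w_inside) auto
      then show ?thesis
        using W_partial[OF that(1,3), of k] by simp
    qed
    then show "\<exists>r>0. \<forall>u v. p \<le> u \<longrightarrow> x - r \<le> u \<longrightarrow> u \<le> v \<longrightarrow> v \<le> x + r \<longrightarrow> v \<le> q \<longrightarrow> real k * (v - u) \<le> W v - W u"
      using r(1) by blast
  qed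
qed

text \<open>
  A major function of \<open>f\<close> becomes one of \<open>g\<close> by adding a steep function for the set where the two
  differ: there its slope exceeds any value of \<open>g - f\<close>, and elsewhere monotonicity does no harm.
  The endpoints are added to the exceptional set.
\<close>
lemma LP_upper_bound_cong_ae:
  assumes f: "LP_upper_bound f p q I" and pq: "p \<le> q"
    and N: "negligible {x \<in> {p<..<q}. f x \<noteq> g x}"
  shows "LP_upper_bound g p q I"
  unfolding LP_upper_bound_def
proof (intro allI impI)
  fix e :: real assume e: "0 < e"
  then obtain U where U: "derivate_above f U p q" "U q - U p \<le> I + e / 2"
    using f unfolding LP_upper_bound_def by (meson half_gt_zero)
  define N where "N = {x \<in> {p..q}. f x \<noteq> g x}"
  have "negligible N"
    by (rule negligible_subset[of "{x \<in> {p<..<q}. f x \<noteq> g x} \<union> {p, q}"]) (use N in \<open>auto simp: N_def\<close>)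
  from null_set_steep_function[OF this half_gt_zero[OF e] pq] obtain W where
    W: "continuous_on {p..q} W" "mono_on {p..q} W" "W q - W p \<le> e / 2"
    and steep: "\<And>x k. x \<in> N \<Longrightarrow> \<exists>r>0. \<forall>u v. p \<le> u \<longrightarrow> x - r \<le> u \<longrightarrow> u \<le> v \<longrightarrow> v \<le> x + r \<longrightarrow> v \<le> q \<longrightarrow>
       real k * (v - u) \<le> W v - W u"
    by blast
  have "laplace_ge \<delta> (increment (\<lambda>x. U x + W x) x \<sigma>) (g x)" if s: "side_within p q x \<sigma> \<delta>" for x \<sigma> \<delta>
  proof -
    have cont: "continuous_on {0..\<delta>} (increment U x \<sigma>)" "continuous_on {0..\<delta>} (increment W x \<sigma>)"
      by (rule continuous_on_increment[OF _ s]; use W derivate_aboveD(2)[OF U(1)] in blast)+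
    have \<delta>: "0 < \<delta>" and \<sigma>: "\<sigma> = 1 \<or> \<sigma> = - 1" and x: "x \<in> {p..q}"
      using s by (auto simp: side_within_def)
    have "\<exists>c. laplace_ge \<delta> (increment W x \<sigma>) c \<and> g x \<le> f x + c"
    proof (cases "x \<in> N")
      case True
      obtain k where k: "g x - f x \<le> real k"
        using real_arch_simple by blast
      obtain r where r: "0 < r" and steep_r: "\<And>u v. p \<le> u \<Longrightarrow> x - r \<le> u \<Longrightarrow> u \<le> v \<Longrightarrow> v \<le> x + r \<Longrightarrow> v \<le> q \<Longrightarrow>
          real k * (v - u) \<le> W v - W u"
        using steep[OF True, of k] by blast
      have "laplace_ge \<delta> (increment W x \<sigma>) (real k)"
      proof (rule laplace_geI[OF cont(2)])
        fix t assume t: "t \<in> {0..min \<delta> r}"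
        with side_withinD[OF s, of t] have "x + \<sigma> * t \<in> {p..q}" by auto
        then show "real k * t \<le> increment W x \<sigma> t"
          using \<sigma> steep_r[of x "x + t"] steep_r[of "x - t" x] t x r by (auto simp: increment_def)
      qed (use \<delta> r in auto)
      then show ?thesis using k by (intro exI[of _ "real k"]) auto
    next
      case False
      have "laplace_ge \<delta> (increment W x \<sigma>) 0"
      proof (rule laplace_geI[OF cont(2) \<delta>])
        fix t assume t: "t \<in> {0..\<delta>}"
        with side_withinD[OF s t] have "x + \<sigma> * t \<in> {p..q}" by auto
        then show "0 * t \<le> increment W x \<sigma> t"
          using \<sigma> mono_onD[OF W(2), of x "x + t"] mono_onD[OF W(2), of "x - t" x] t x by (auto simp: increment_def)
      qed simp
      then show ?thesis using False x by (intro exI[of _ 0]) (auto simp: N_def)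
    qed
    then obtain c where c: "laplace_ge \<delta> (increment W x \<sigma>) c" "g x \<le> f x + c"
      by blast
    from laplace_ge_mono[OF laplace_ge_add[OF cont derivate_aboveD(1)[OF U(1) s] c(1)] c(2)] show ?thesis
      by (simp add: increment_add[abs_def])
  qed
  moreover have "continuous_on {p..q} (\<lambda>x. U x + W x)"
    by (intro continuous_intros W derivate_aboveD(2)[OF U(1)])
  moreover have "(U q + W q) - (U p + W p) \<le> I + e"
    using U(2) W(3) by (simp add: field_simps)
  ultimately show "\<exists>U. derivate_above g U p q \<and> U q - U p \<le> I + e"
    unfolding derivate_above_def by (intro exI[of _ "\<lambda>x. U x + W x"]) auto
qed

lemma LP_compact_cong_ae:
  assumes "LP_compact f p q I" "negligible {x \<in> {p<..<q}. f x \<noteq> g x}"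
  shows "LP_compact g p q I"
  using assms LP_upper_bound_cong_ae[of f p q I g] LP_upper_bound_cong_ae[of "\<lambda>x. - f x" p q "- I" "\<lambda>x. - g x"]
  by (simp add: LP_compact_def)

section \<open>Differentiation of indefinite integrals\<close>

text \<open>
  A weak-type maximal inequality. Around each point of the set choose an interval on which \<open>R\<close>
  grows by more than \<open>c\<close> times its radius. Vitali's covering lemma gives disjoint ones among them
  whose fivefold enlargements cover the set; their radii have sum at most \<open>e / c\<close> because the
  increments of \<open>R\<close> over disjoint intervals have sum at most \<open>e\<close>.
\<close>
lemma monotone_steep_set_cover:
  fixes R :: "real \<Rightarrow> real"
  assumes mono: "mono R" and cont: "continuous_on UNIV R" and osc: "\<And>x y. R y - R x \<le> e" and c: "0 < c"
  shows "\<exists>T\<in>lmeasurable. {x. \<exists>t>0. c * t < R (x + t) - R (x - t)} \<subseteq> T \<and> measure lebesgue T \<le> 10 * e / c"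
proof -
  define S where "S = {x. \<exists>t>0. c * t < R (x + t) - R (x - t)}"
  have e0: "0 \<le> e" using osc[of 0 0] by simp
  have "\<forall>x\<in>S. \<exists>t. 0 < t \<and> c * t < R (x + t) - R (x - t)"
    by (simp add: S_def)
  from bchoice[OF this] obtain r where r: "\<And>x. x \<in> S \<Longrightarrow> 0 < r x \<and> c * r x < R (x + r x) - R (x - r x)"
    by blast
  have r_bound: "0 < r x \<and> r x \<le> e / c" if "x \<in> S" for x
    using r[OF that] osc[of "x + r x" "x - r x"] c by (auto simp: field_simps)
  have cover: "S \<subseteq> (\<Union>x\<in>S. cball x (r x))"
  proof
    fix x assume "x \<in> S"
    then show "x \<in> (\<Union>x\<in>S. cball x (r x))"
      using r[of x] by (intro UN_I[of x]) auto
  qed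
  obtain C where
    C: "countable C" "C \<subseteq> S" "pairwise (\<lambda>x y. disjnt (cball x (r x)) (cball y (r y))) C"
      "S \<subseteq> (\<Union>x\<in>C. cball x (5 * r x))"
    by (rule Vitali_covering_lemma_cballs[OF cover r_bound])
  have Icc: "emeasure (interval_measure R) {u..v} = ennreal (R v - R u)" if "u \<le> v" for u v
    using that mono cont by (intro emeasure_interval_measure_Icc) (auto dest: monoD)
  \<comment> \<open>The Stieltjes measure of \<open>R\<close> is additive over the disjoint intervals.\<close>
  have finite_sum: "(\<Sum>x\<in>F. R (x + r x) - R (x - r x)) \<le> e" if F: "finite F" "F \<subseteq> C" for F
  proof -
    have rF: "0 < r x" if "x \<in> F" for x using r F C that by blast
    have "bounded (\<Union>x\<in>F. cball x (r x))"
      using F(1) by (intro bounded_UN) auto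
    then obtain B where B: "\<And>x. x \<in> (\<Union>x\<in>F. cball x (r x)) \<Longrightarrow> norm x \<le> B"
      unfolding bounded_iff by blast
    have "ennreal (\<Sum>x\<in>F. R (x + r x) - R (x - r x)) = (\<Sum>x\<in>F. emeasure (interval_measure R) (cball x (r x)))"
      using rF monoD[OF mono]
      by (subst sum_ennreal[symmetric]) (auto intro!: sum.cong simp: cball_eq_atLeastAtMost Icc less_imp_le)
    also have "\<dots> = emeasure (interval_measure R) (\<Union>x\<in>F. cball x (r x))"
      using C(3) F
      by (intro sum_emeasure) (auto simp: disjoint_family_on_def pairwise_def disjnt_def)
    also have "\<dots> \<le> emeasure (interval_measure R) {- max B 0..max B 0}"
    proof (rule emeasure_mono)
      show "(\<Union>x\<in>F. cball x (r x)) \<subseteq> {- max B 0..max B 0}"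
      proof
        fix y assume "y \<in> (\<Union>x\<in>F. cball x (r x))"
        from B[OF this] show "y \<in> {- max B 0..max B 0}" by auto
      qed
    qed simp
    also have "\<dots> = ennreal (R (max B 0) - R (- max B 0))"
      by (intro Icc) auto
    also have "\<dots> \<le> ennreal e"
      by (intro ennreal_leI osc)
    finally show ?thesis
      using e0 by simp
  qed
  have union_bound: "measure lebesgue (\<Union>x\<in>F. cball x (5 * r x)) \<le> 10 * e / c" if F: "finite F" "F \<subseteq> C" for F
  proof -
    have rF: "0 < r x" "c * r x < R (x + r x) - R (x - r x)" if "x \<in> F" for x using r F C that by blast+
    have "measure lebesgue (\<Union>x\<in>F. cball x (5 * r x)) \<le> (\<Sum>x\<in>F. measure lebesgue (cball x (5 * r x)))"
      by (rule measure_UNION_le) (use F in auto)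
    also have "\<dots> = (\<Sum>x\<in>F. 10 * r x)"
      using rF by (intro sum.cong) (auto simp: cball_eq_atLeastAtMost less_imp_le)
    also have "\<dots> \<le> (\<Sum>x\<in>F. 10 / c * (R (x + r x) - R (x - r x)))"
    proof (rule sum_mono)
      fix x assume "x \<in> F"
      from rF(2)[OF this] c show "10 * r x \<le> 10 / c * (R (x + r x) - R (x - r x))"
        by (simp add: pos_le_divide_eq mult.commute)
    qed
    also have "\<dots> \<le> 10 / c * e"
      unfolding sum_distrib_left[symmetric] using c by (intro mult_left_mono finite_sum F) auto
    finally show ?thesis by simp
  qed
  have ball: "cball x (5 * r x) \<in> lmeasurable" for x by simp
  have "(\<Union>x\<in>C. cball x (5 * r x)) \<in> lmeasurable"
    by (rule fmeasurable_UN_bound[OF C(1) ball]) (use union_bound in blast)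
  moreover have "measure lebesgue (\<Union>x\<in>C. cball x (5 * r x)) \<le> 10 * e / c"
    by (rule measure_UN_bound[OF C(1) ball]) (use union_bound in blast)
  ultimately show ?thesis
    using C(4) unfolding S_def by blast
qed

text \<open>
  The lower derivates of the indefinite integral are almost everywhere at least \<open>f\<close>. Write
  \<open>\<Phi> = U - R\<close> with \<open>U\<close> a major function and \<open>R\<close> monotone of small increase. Where the derivates of
  \<open>\<Phi>\<close> fall short of \<open>f\<close> by \<open>c\<close>, the function \<open>R\<close> must be steep, and by
  \<open>monotone_steep_set_cover\<close> this happens only on a set of small measure.
\<close>
lemma major_approximable_derivate_ae:
  assumes \<Phi>: "continuous_on {p..q} \<Phi>" and approx: "major_approximable f \<Phi> p q"
  shows "negligible {x \<in> {p<..<q}. \<exists>\<sigma> \<delta>. side_within p q x \<sigma> \<delta> \<and> \<not> laplace_ge \<delta> (increment \<Phi> x \<sigma>) (f x)}"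
proof -
  define B where "B c = {x \<in> {p<..<q}. \<exists>\<sigma> \<delta>. side_within p q x \<sigma> \<delta> \<and> \<not> laplace_ge \<delta> (increment \<Phi> x \<sigma>) (f x - c)}" for c
  have "negligible (B c)" if c: "0 < c" for c
  proof (cases "p \<le> q")
    case pq: True
    show ?thesis
      unfolding negligible_outer_le
    proof (intro allI impI)
      fix e :: real assume e: "0 < e"
      \<comment> \<open>This total increase makes the bound \<open>10 * h / c\<close> of the covering lemma equal to \<open>e\<close>.\<close>
      define h where "h = e * c / 10"
      have "0 < h" using c e by (simp add: h_def)
      then obtain U where U: "derivate_above f U p q" "mono_on {p..q} (\<lambda>x. U x - \<Phi> x)"
          "(U q - \<Phi> q) - (U p - \<Phi> p) \<le> h"
        using approx unfolding major_approximable_def by blast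
      \<comment> \<open>\<open>R\<close> extends \<open>U - \<Phi>\<close> by constants, so symmetric intervals may leave \<open>{p..q}\<close>.\<close>
      define k where "k x = max p (min q x)" for x
      have k: "k x \<in> {p..q}" "x \<in> {p..q} \<Longrightarrow> k x = x" "x \<le> y \<Longrightarrow> k x \<le> k y" for x y
        using pq by (auto simp: k_def)
      have U_cont: "continuous_on {p..q} U" by (rule derivate_aboveD(2)[OF U(1)])
      define R where "R x = U (k x) - \<Phi> (k x)" for x
      have R: "R x = U x - \<Phi> x" if "x \<in> {p..q}" for x
        using k(2)[OF that] by (simp add: R_def)
      have "mono R"
        unfolding R_def by (rule monoI) (use mono_onD[OF U(2)] k in blast)
      moreover have "continuous_on UNIV R"
        unfolding R_def
      proof (intro continuous_intros)
        have "continuous_on UNIV k" unfolding k_def by (intro continuous_intros)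
        then show "continuous_on UNIV (\<lambda>x. U (k x))" "continuous_on UNIV (\<lambda>x. \<Phi> (k x))"
          using k(1) by (auto intro: continuous_on_compose2[OF U_cont] continuous_on_compose2[OF \<Phi>])
      qed
      moreover have "R y - R x \<le> h" for x y
      proof -
        have "R y \<le> U q - \<Phi> q" "U p - \<Phi> p \<le> R x"
          unfolding R_def using k(1) pq by (auto intro!: mono_onD[OF U(2)])
        then show ?thesis using U(3) by simp
      qed
      ultimately obtain T where T: "T \<in> lmeasurable" "{x. \<exists>t>0. c * t < R (x + t) - R (x - t)} \<subseteq> T"
          "measure lebesgue T \<le> 10 * h / c"
        using monotone_steep_set_cover[of R h c] c by blast
      have "B c \<subseteq> {x. \<exists>t>0. c * t < R (x + t) - R (x - t)}"
      proof
        fix x assume "x \<in> B c"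
        then obtain \<sigma> \<delta> where s: "side_within p q x \<sigma> \<delta>" and bad: "\<not> laplace_ge \<delta> (increment \<Phi> x \<sigma>) (f x - c)"
          by (auto simp: B_def)
        show "x \<in> {x. \<exists>t>0. c * t < R (x + t) - R (x - t)}"
        proof (rule ccontr)
          assume *: "x \<notin> {x. \<exists>t>0. c * t < R (x + t) - R (x - t)}"
          have flat: "R (x + t) - R (x - t) \<le> c * t" if "0 < t" for t
            using that * not_less by blast
          have \<delta>: "0 < \<delta>" and \<sigma>: "\<sigma> = 1 \<or> \<sigma> = - 1" and x: "x \<in> {p..q}"
            using s by (auto simp: side_within_def)
          have inc: "increment R x \<sigma> t = increment U x \<sigma> t - increment \<Phi> x \<sigma> t" if "t \<in> {0..\<delta>}" for t
            unfolding increment_def R[OF x] R[OF side_withinD[OF s that]] by (simp add: algebra_simps)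
          have cont: "continuous_on {0..\<delta>} (increment U x \<sigma>)" "continuous_on {0..\<delta>} (increment \<Phi> x \<sigma>)"
            by (rule continuous_on_increment[OF U_cont s], rule continuous_on_increment[OF \<Phi> s])
          have cont_R: "continuous_on {0..\<delta>} (\<lambda>t. increment \<Phi> x \<sigma> t - increment U x \<sigma> t)"
            by (intro continuous_intros cont)
          have "laplace_ge \<delta> (\<lambda>t. increment \<Phi> x \<sigma> t - increment U x \<sigma> t) (- c)"
          proof (rule laplace_geI[OF cont_R \<delta> order_refl])
            fix t assume t: "t \<in> {0..\<delta>}"
            have "increment R x \<sigma> t \<le> c * t"
            proof (cases "t = 0")
              case False
              then have "R (x - t) \<le> R x" "R x \<le> R (x + t)" "R (x + t) - R (x - t) \<le> c * t"
                using t flat[of t] monoD[OF \<open>mono R\<close>, of "x - t" x] monoD[OF \<open>mono R\<close>, of x "x + t"]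
                by auto
              then show ?thesis using \<sigma> by (auto simp: increment_def)
            qed (simp add: increment_def)
            then show "- c * t \<le> increment \<Phi> x \<sigma> t - increment U x \<sigma> t"
              using inc[OF t] by simp
          qed
          from laplace_ge_add[OF cont(1) cont_R derivate_aboveD(1)[OF U(1) s] this]
          have "laplace_ge \<delta> (increment \<Phi> x \<sigma>) (f x - c)"
            by simp
          with bad show False ..
        qed
      qed
      moreover have "10 * h / c = e" using c by (simp add: h_def)
      ultimately show "\<exists>T. B c \<subseteq> T \<and> T \<in> lmeasurable \<and> measure lebesgue T \<le> e"
        using T by auto
    qed
  qed (simp add: B_def)
  then have "negligible (\<Union>n. B (inverse (real (Suc n))))"
    by (intro negligible_countable_Union) auto
  moreover have "{x \<in> {p<..<q}. \<exists>\<sigma> \<delta>. side_within p q x \<sigma> \<delta> \<and> \<not> laplace_ge \<delta> (increment \<Phi> x \<sigma>) (f x)}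
      \<subseteq> (\<Union>n. B (inverse (real (Suc n))))"
  proof
    fix x assume "x \<in> {x \<in> {p<..<q}. \<exists>\<sigma> \<delta>. side_within p q x \<sigma> \<delta> \<and> \<not> laplace_ge \<delta> (increment \<Phi> x \<sigma>) (f x)}"
    then obtain \<sigma> \<delta> where x: "x \<in> {p<..<q}" "side_within p q x \<sigma> \<delta>" and bad: "\<not> laplace_ge \<delta> (increment \<Phi> x \<sigma>) (f x)"
      by blast
    from bad obtain d where d: "d < f x" "\<not> (\<forall>\<^sub>F s in at_top. d < laplace_quotient \<delta> (increment \<Phi> x \<sigma>) s)"
      unfolding laplace_ge_def by blast
    obtain n where "inverse (real (Suc n)) < f x - d"
      using reals_Archimedean[of "f x - d"] d(1) by auto
    then have "\<not> laplace_ge \<delta> (increment \<Phi> x \<sigma>) (f x - inverse (real (Suc n)))"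
      using d(2) unfolding laplace_ge_def by (auto intro!: exI[of _ d])
    then show "x \<in> (\<Union>n. B (inverse (real (Suc n))))"
      using x unfolding B_def by blast
  qed
  ultimately show ?thesis
    by (rule negligible_subset)
qed

lemma laplace_ge_tendsto:
  assumes "laplace_ge \<delta> w c" "laplace_ge \<delta> (\<lambda>t. - w t) (- c)"
  shows "(laplace_quotient \<delta> w \<longlongrightarrow> c) at_top"
proof (rule order_tendstoI)
  fix d assume "d < c"
  then show "\<forall>\<^sub>F s in at_top. d < laplace_quotient \<delta> w s"
    using assms(1) by (simp add: laplace_ge_def)
next
  fix d assume "c < d"
  then have "\<forall>\<^sub>F s in at_top. - d < laplace_quotient \<delta> (\<lambda>t. - w t) s"
    using assms(2) by (simp add: laplace_ge_def)
  then show "\<forall>\<^sub>F s in at_top. laplace_quotient \<delta> w s < d"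
    by (simp add: laplace_quotient_minus)
qed

text \<open>
  The lower bound of \<open>major_approximable_derivate_ae\<close>, applied to \<open>\<Phi>\<close> and to \<open>- \<Phi>\<close>, encloses the
  quotients.
\<close>
lemma LP_primitive_derivative_ae:
  assumes \<Phi>: "continuous_on {p..q} \<Phi>"
    and "major_approximable f \<Phi> p q" "major_approximable (\<lambda>x. - f x) (\<lambda>x. - \<Phi> x) p q"
  shows "AE x in lebesgue. p < x \<and> x < q \<longrightarrow>
    (\<forall>\<sigma> \<delta>. side_within p q x \<sigma> \<delta> \<longrightarrow> (laplace_quotient \<delta> (increment \<Phi> x \<sigma>) \<longlongrightarrow> f x) at_top)"
proof -
  define N1 where "N1 = {x \<in> {p<..<q}. \<exists>\<sigma> \<delta>. side_within p q x \<sigma> \<delta> \<and> \<not> laplace_ge \<delta> (increment \<Phi> x \<sigma>) (f x)}"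
  define N2 where "N2 = {x \<in> {p<..<q}. \<exists>\<sigma> \<delta>. side_within p q x \<sigma> \<delta> \<and> \<not> laplace_ge \<delta> (increment (\<lambda>x. - \<Phi> x) x \<sigma>) (- f x)}"
  have "negligible N1" "negligible N2"
    unfolding N1_def N2_def
    by (rule major_approximable_derivate_ae[OF \<Phi> assms(2)], rule major_approximable_derivate_ae[OF continuous_on_minus[OF \<Phi>] assms(3)])
  then have "N1 \<union> N2 \<in> null_sets lebesgue"
    by (simp flip: negligible_iff_null_sets)
  from AE_not_in[OF this] show ?thesis
  proof (rule eventually_mono, intro impI allI)
    fix x \<sigma> \<delta> assume "x \<notin> N1 \<union> N2" "p < x \<and> x < q" "side_within p q x \<sigma> \<delta>"
    then show "(laplace_quotient \<delta> (increment \<Phi> x \<sigma>) \<longlongrightarrow> f x) at_top"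
      by (intro laplace_ge_tendsto) (auto simp: N1_def N2_def increment_minus[abs_def])
  qed
qed

section \<open>Uniqueness of integrals and derivatives\<close>

lemma laplace_ge_approx:
  assumes "\<And>d. d < c \<Longrightarrow> laplace_ge \<delta> w d"
  shows "laplace_ge \<delta> w c"
  unfolding laplace_ge_def
proof (intro allI impI)
  fix d assume "d < c"
  then obtain e where "d < e" "e < c" using dense by blast
  then show "\<forall>\<^sub>F s in at_top. d < laplace_quotient \<delta> w s"
    using assms[of e] by (simp add: laplace_ge_def)
qed

text \<open>
  For continuous \<open>h\<close> the Riemann integral is itself a major function. Hence the Laplace integrals
  in the definition of the Laplace derivative of a continuous function are Riemann integrals.
\<close>
lemma LP_upper_bound_continuous:
  assumes h: "continuous_on {p..q} h"
  shows "LP_upper_bound h p q (integral {p..q} h)"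
proof -
  define \<Phi> where "\<Phi> x = integral {p..x} h" for x
  have int: "h integrable_on {u..v}" if "p \<le> u" "v \<le> q" for u v
    using that by (intro integrable_continuous_real continuous_on_subset[OF h]) auto
  have \<Phi>_cont: "continuous_on {p..q} \<Phi>"
    unfolding \<Phi>_def by (rule indefinite_integral_continuous_1) (rule int; simp)
  have \<Phi>_diff: "\<Phi> v - \<Phi> u = integral {u..v} h" if "p \<le> u" "u \<le> v" "v \<le> q" for u v
    using Henstock_Kurzweil_Integration.integral_combine[OF that(1,2), of h] int[of p v] that by (simp add: \<Phi>_def)
  have \<Phi>_ge: "c * (v - u) \<le> \<Phi> v - \<Phi> u" if "p \<le> u" "u \<le> v" "v \<le> q" "\<And>y. y \<in> {u..v} \<Longrightarrow> c \<le> h y" for u v c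
  proof -
    have "integral {u..v} (\<lambda>y. c) \<le> integral {u..v} h"
      by (rule integral_le) (use that int in auto)
    then show ?thesis using \<Phi>_diff that by (simp add: mult.commute)
  qed
  have "derivate_above h \<Phi> p q"
    unfolding derivate_above_def
  proof (intro conjI allI impI \<Phi>_cont)
    fix x \<sigma> \<delta> assume s: "side_within p q x \<sigma> \<delta>"
    then have \<delta>: "0 < \<delta>" and \<sigma>: "\<sigma> = 1 \<or> \<sigma> = - 1" and x: "x \<in> {p..q}"
      by (auto simp: side_within_def)
    show "laplace_ge \<delta> (increment \<Phi> x \<sigma>) (h x)"
    proof (rule laplace_ge_approx)
      fix c assume "c < h x"
      then have "0 < h x - c" by simp
      from continuous_onE[OF h x this] obtain r where r: "0 < r"
          and close: "\<And>y. y \<in> {p..q} \<Longrightarrow> dist y x \<le> r \<Longrightarrow> dist (h y) (h x) < h x - c"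
        by blast
      have h_ge: "c \<le> h y" if "y \<in> {p..q}" "\<bar>y - x\<bar> \<le> r" for y
        using close[OF that(1)] that(2) by (auto simp: dist_real_def)
      show "laplace_ge \<delta> (increment \<Phi> x \<sigma>) c"
      proof (rule laplace_geI[OF continuous_on_increment[OF \<Phi>_cont s], of "min \<delta> r"])
        fix t assume t: "t \<in> {0..min \<delta> r}"
        with side_withinD[OF s, of t] have xt: "x + \<sigma> * t \<in> {p..q}" by auto
        show "c * t \<le> increment \<Phi> x \<sigma> t"
        proof (cases "\<sigma> = 1")
          case True
          then have "c * (x + t - x) \<le> \<Phi> (x + t) - \<Phi> x"
            using t x xt by (intro \<Phi>_ge h_ge) auto
          then show ?thesis using True by (simp add: increment_def)
        next
          case False
          then have "c * (x - (x - t)) \<le> \<Phi> x - \<Phi> (x - t)"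
            using t x xt \<sigma> by (intro \<Phi>_ge h_ge) auto
          then show ?thesis using False \<sigma> by (auto simp: increment_def)
        qed
      qed (use \<delta> r in auto)
    qed
  qed
  then show ?thesis
    unfolding LP_upper_bound_def by (intro allI impI exI[of _ \<Phi>]) (simp add: \<Phi>_def)
qed

lemma LP_compact_continuous:
  assumes "p \<le> q" "continuous_on {p..q} h"
  shows "LP_compact h p q (integral {p..q} h)"
  using assms LP_upper_bound_continuous[OF assms(2)] LP_upper_bound_continuous[OF continuous_on_minus[OF assms(2)]]
  by (simp add: LP_compact_def)

text \<open>
  Two indefinite integrals differ by a constant on the real points, and by continuity also at
  infinite endpoints.
\<close>
lemma LP_indefinite_unique:
  assumes \<Phi>: "LP_indefinite f a b \<Phi>" and \<Psi>: "LP_indefinite f a b \<Psi>" and ab: "a < b"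
  shows "\<Phi> b - \<Phi> a = \<Psi> b - \<Psi> a"
proof -
  define D where "D x = \<Phi> x - \<Psi> x" for x
  have D_cont: "continuous_on {a..b} D"
    unfolding D_def by (intro continuous_intros LP_indefiniteD(1)[OF \<Phi>] LP_indefiniteD(1)[OF \<Psi>])
  obtain r where r: "a < ereal r" "ereal r < b"
    using ereal_dense2[OF ab] by blast
  have D_eq: "D (ereal u) = D (ereal v)" if "u \<le> v" "a \<le> ereal u" "ereal v \<le> b" for u v
    using LP_compact_unique[OF LP_indefiniteD(2)[OF \<Phi> that] LP_indefiniteD(2)[OF \<Psi> that]] by (simp add: D_def)
  have "D b = D (ereal r)"
  proof (cases b)
    case (real q)
    then show ?thesis using D_eq[of r q] r by simp
  next
    case PInf
    have "((\<lambda>x. D (ereal x)) \<longlongrightarrow> D \<infinity>) at_top"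
      using D_cont PInf ab by (intro continuous_on_ereal_at_top) auto
    moreover have "\<forall>\<^sub>F x in at_top. D (ereal r) = D (ereal x)"
      using eventually_ge_at_top[of r] by eventually_elim (rule D_eq; use r PInf in simp)
    then have "((\<lambda>x. D (ereal x)) \<longlongrightarrow> D (ereal r)) at_top"
      by (rule Lim_transform_eventually[OF tendsto_const])
    ultimately show ?thesis
      using PInf tendsto_unique[OF trivial_limit_at_top_linorder] by blast
  qed (use ab in auto)
  moreover have "D a = D (ereal r)"
  proof (cases a)
    case (real p)
    then show ?thesis using D_eq[of p r] r by simp
  next
    case MInf
    have "((\<lambda>x. D (ereal x)) \<longlongrightarrow> D (-\<infinity>)) at_bot"
      using D_cont MInf ab by (intro continuous_on_ereal_at_bot) auto
    moreover have "\<forall>\<^sub>F x in at_bot. D (ereal r) = D (ereal x)"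
      using eventually_le_at_bot[of r] by eventually_elim (rule D_eq[symmetric]; use r MInf in simp)
    then have "((\<lambda>x. D (ereal x)) \<longlongrightarrow> D (ereal r)) at_bot"
      by (rule Lim_transform_eventually[OF tendsto_const])
    ultimately show ?thesis
      using MInf tendsto_unique[OF trivial_limit_at_bot_linorder] by blast
  qed (use ab in auto)
  ultimately show ?thesis by (simp add: D_def)
qed

lemma LP_indefinite_cong_ae:
  assumes \<Phi>: "LP_indefinite f a b \<Phi>"
    and eq: "AE x in lebesgue. a < ereal x \<and> ereal x < b \<longrightarrow> f x = g x"
  shows "LP_indefinite g a b \<Phi>"
  unfolding LP_indefinite_def
proof (intro conjI allI impI LP_indefiniteD(1)[OF \<Phi>])
  fix u v assume uv: "u \<le> v" "a \<le> ereal u" "ereal v \<le> b"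
  show "LP_compact g u v (\<Phi> (ereal v) - \<Phi> (ereal u))"
  proof (rule LP_compact_cong_ae[OF LP_indefiniteD(2)[OF \<Phi> uv]])
    obtain N where N: "N \<in> null_sets lebesgue" "{x. \<not> (a < ereal x \<and> ereal x < b \<longrightarrow> f x = g x)} \<subseteq> N"
      using eq by (auto simp: eventually_ae_filter)
    have "{x \<in> {u<..<v}. f x \<noteq> g x} \<subseteq> N"
    proof
      fix x assume x: "x \<in> {x \<in> {u<..<v}. f x \<noteq> g x}"
      have "a < ereal x" "ereal x < b"
        using x uv by (auto intro: le_less_trans[of a "ereal u"] less_le_trans[of _ "ereal v" b])
      with x N(2) show "x \<in> N" by auto
    qed
    with N(1) show "negligible {x \<in> {u<..<v}. f x \<noteq> g x}"
      by (auto simp: negligible_iff_null_sets[symmetric] intro: negligible_subset)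
  qed
qed

lemma has_LP_integral_unique_ae:
  assumes "has_LP_integral f a b I" "has_LP_integral g a b J"
    and eq: "AE x in lebesgue. min a b < ereal x \<and> ereal x < max a b \<longrightarrow> f x = g x"
  shows "I = J"
proof -
  have less: "I = J" if ab: "a < b" and fg: "has_LP_integral f a b I" "has_LP_integral g a b J"
    and ae: "AE x in lebesgue. a < ereal x \<and> ereal x < b \<longrightarrow> f x = g x" for a b I J
  proof -
    obtain \<Phi> where \<Phi>: "LP_indefinite f a b \<Phi>" "I = \<Phi> b - \<Phi> a"
      using fg(1) has_LP_integral_iff_indefinite[OF ab] by blast
    obtain \<Psi> where \<Psi>: "LP_indefinite g a b \<Psi>" "J = \<Psi> b - \<Psi> a"
      using fg(2) has_LP_integral_iff_indefinite[OF ab] by blast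
    show ?thesis
      using LP_indefinite_unique[OF LP_indefinite_cong_ae[OF \<Phi>(1) ae] \<Psi>(1) ab] \<Phi>(2) \<Psi>(2) by simp
  qed
  consider "a < b" | "a = b" | "b < a" by force
  then show ?thesis
  proof cases
    case 1
    then show ?thesis using less[OF 1 assms(1,2)] eq by (simp add: min_def max_def less_imp_le)
  next
    case 2
    then show ?thesis using assms(1,2) by (simp add: has_LP_integral_refl_iff)
  next
    case 3
    have "min a b = b" "max a b = a" using 3 by (simp_all add: less_imp_le min_absorb2 max_absorb1)
    then have "- I = - J"
      using assms(1,2) eq by (intro less[OF 3]) (simp_all add: has_LP_integral_reverse_iff[OF 3])
    then show ?thesis by simp
  qed
qed

text \<open>
  The values of the partially defined integrand need to be unique only almost everywhere. This
  is what the nested integrals require, where uniqueness holds for the continuous sections only.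
\<close>
lemma has_ae_LP_integral_unique:
  assumes "has_ae_LP_integral P a b I" "has_ae_LP_integral P a b J"
    and unique: "AE x in lebesgue. min a b < ereal x \<and> ereal x < max a b \<longrightarrow> (\<forall>v w. P x v \<longrightarrow> P x w \<longrightarrow> v = w)"
  shows "I = J"
proof -
  obtain g where g: "AE x in lebesgue. min a b < ereal x \<and> ereal x < max a b \<longrightarrow> P x (g x)" "has_LP_integral g a b I"
    using assms(1) by (auto simp: has_ae_LP_integral_def)
  obtain h where h: "AE x in lebesgue. min a b < ereal x \<and> ereal x < max a b \<longrightarrow> P x (h x)" "has_LP_integral h a b J"
    using assms(2) by (auto simp: has_ae_LP_integral_def)
  have "AE x in lebesgue. min a b < ereal x \<and> ereal x < max a b \<longrightarrow> g x = h x"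
    using g(1) h(1) unique by eventually_elim blast
  then show ?thesis
    by (rule has_LP_integral_unique_ae[OF g(2) h(2)])
qed

text \<open>
  For a continuous function all Laplace integrals in the definition exist, and those in \<open>R\<close> and \<open>L\<close>
  are the integrals in \<open>laplace_quotient\<close>.
\<close>
lemma has_LD1_continuous_iff:
  assumes F: "continuous_on {c..d} F"
  shows "has_LD1 c d F x l \<longleftrightarrow> (\<exists>\<delta>>0. {ereal (x - \<delta>)..ereal (x + \<delta>)} \<subseteq> {c..d} \<and>
    (\<forall>\<sigma>\<in>{1, - 1}. (laplace_quotient \<delta> (increment (\<lambda>t. F (ereal t)) x \<sigma>) \<longlongrightarrow> l) at_top))"
proof -
  have "(\<exists>I. has_LP_integral (\<lambda>t. F (ereal t)) (ereal (x - \<delta>)) (ereal (x + \<delta>)) I) \<and>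
        (\<exists>R. (\<forall>\<^sub>F s in at_top. has_LP_integral
                (\<lambda>t. exp (- s * t) * (F (ereal (x + t)) - F (ereal x))) 0 (ereal \<delta>) (R s)) \<and>
             ((\<lambda>s::real. s\<^sup>2 * R s) \<longlongrightarrow> l) at_top) \<and>
        (\<exists>L. (\<forall>\<^sub>F s in at_top. has_LP_integral
                (\<lambda>t. exp (- s * t) * (F (ereal (x - t)) - F (ereal x))) 0 (ereal \<delta>) (L s)) \<and>
             ((\<lambda>s::real. - s\<^sup>2 * L s) \<longlongrightarrow> l) at_top)
      \<longleftrightarrow> (\<forall>\<sigma>\<in>{1, - 1}. (laplace_quotient \<delta> (increment (\<lambda>t. F (ereal t)) x \<sigma>) \<longlongrightarrow> l) at_top)"
    (is "?I \<and> ?R \<and> ?L \<longleftrightarrow> _")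
    if \<delta>: "0 < \<delta>" and sub: "{ereal (x - \<delta>)..ereal (x + \<delta>)} \<subseteq> {c..d}" for \<delta>
  proof -
    define U where "U t = F (ereal t)" for t
    have U: "continuous_on {x - \<delta>..x + \<delta>} U"
      unfolding U_def by (rule continuous_on_real_to_ereal[OF continuous_on_subset[OF F sub]])
    have integral_iff: "has_LP_integral (\<lambda>t. exp (- s * t) * w t) 0 (ereal \<delta>) K \<longleftrightarrow>
        K = integral {0..\<delta>} (\<lambda>t. exp (- s * t) * w t)" if "continuous_on {0..\<delta>} w" for w s K
    proof -
      have "LP_compact (\<lambda>t. exp (- s * t) * w t) 0 \<delta> (integral {0..\<delta>} (\<lambda>t. exp (- s * t) * w t))"
        using \<delta> that by (intro LP_compact_continuous continuous_intros) auto
      note LP = this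
      have "has_LP_integral (\<lambda>t. exp (- s * t) * w t) 0 (ereal \<delta>) K \<longleftrightarrow> LP_compact (\<lambda>t. exp (- s * t) * w t) 0 \<delta> K"
        unfolding zero_ereal_def by (rule has_LP_integral_compact_iff) (use \<delta> in simp)
      then show ?thesis
        using LP LP_compact_unique[OF LP, of K] by blast
    qed
    have cont: "continuous_on {0..\<delta>} (\<lambda>t. U (x + t) - U x)" "continuous_on {0..\<delta>} (\<lambda>t. U (x - t) - U x)"
      using \<delta> by (intro continuous_intros continuous_on_compose2[OF U]; auto)+
    have eventually_eq: "(\<exists>R. (\<forall>\<^sub>F s in at_top. R s = J s) \<and> ((\<lambda>s. k s * R s) \<longlongrightarrow> l) at_top) \<longleftrightarrow>
        ((\<lambda>s. k s * J s) \<longlongrightarrow> l) at_top" for J k :: "real \<Rightarrow> real"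
    proof
      assume "\<exists>R. (\<forall>\<^sub>F s in at_top. R s = J s) \<and> ((\<lambda>s. k s * R s) \<longlongrightarrow> l) at_top"
      then obtain R where R: "\<forall>\<^sub>F s in at_top. R s = J s" "((\<lambda>s. k s * R s) \<longlongrightarrow> l) at_top" by blast
      from R(1) have "\<forall>\<^sub>F s in at_top. k s * R s = k s * J s"
        by eventually_elim simp
      then show "((\<lambda>s. k s * J s) \<longlongrightarrow> l) at_top"
        by (rule Lim_transform_eventually[OF R(2)])
    qed (auto intro!: exI[of _ J])
    have I: ?I
      using LP_compact_continuous[OF _ U] \<delta> has_LP_integral_compact_iff[of "x - \<delta>" "x + \<delta>"]
      by (auto simp: U_def[abs_def])
    have R: "?R \<longleftrightarrow> (laplace_quotient \<delta> (increment U x 1) \<longlongrightarrow> l) at_top"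
      unfolding U_def[symmetric] integral_iff[OF cont(1)] eventually_eq right_left_quotients ..
    have L: "?L \<longleftrightarrow> (laplace_quotient \<delta> (increment U x (- 1)) \<longlongrightarrow> l) at_top"
      unfolding U_def[symmetric] integral_iff[OF cont(2)] eventually_eq right_left_quotients ..
    show ?thesis
      unfolding R L using I by (simp add: U_def[abs_def])
  qed
  then show ?thesis
    unfolding has_LD1_def by (intro ex_cong1 conj_cong refl) blast
qed

text \<open>
  Two derivatives may be witnessed by neighbourhoods of different length; by
  \<open>laplace_quotient_local\<close> both lengths give the same limit. This uses continuity.
\<close>
lemma has_LD1_unique:
  assumes F: "continuous_on {c..d} F" and "has_LD1 c d F x l" "has_LD1 c d F x m"
  shows "l = m"
proof -
  define U where "U t = F (ereal t)" for t
  have eq: "l = m" if lim: "(laplace_quotient \<delta> (increment U x 1) \<longlongrightarrow> l) at_top"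
      "(laplace_quotient \<eta> (increment U x 1) \<longlongrightarrow> m) at_top"
      and \<delta>: "0 < \<eta>" "\<eta> \<le> \<delta>" and sub: "{ereal (x - \<delta>)..ereal (x + \<delta>)} \<subseteq> {c..d}" for l m \<delta> \<eta>
  proof -
    have "continuous_on {x - \<delta>..x + \<delta>} U"
      unfolding U_def by (rule continuous_on_real_to_ereal[OF continuous_on_subset[OF F sub]])
    then have "continuous_on {0..\<delta>} (increment U x 1)"
      by (rule continuous_on_increment) (use \<delta> in \<open>auto simp: side_within_def\<close>)
    from laplace_quotient_local[OF this \<delta>]
    have "((\<lambda>s. laplace_quotient \<delta> (increment U x 1) s - laplace_quotient \<eta> (increment U x 1) s) \<longlongrightarrow> 0) at_top" .
    moreover have "((\<lambda>s. laplace_quotient \<delta> (increment U x 1) s - laplace_quotient \<eta> (increment U x 1) s) \<longlongrightarrow> l - m) at_top"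
      by (rule tendsto_diff[OF lim])
    ultimately have "0 = l - m"
      by (rule tendsto_unique[OF trivial_limit_at_top_linorder])
    then show ?thesis by simp
  qed
  obtain \<delta> where \<delta>: "0 < \<delta>" "{ereal (x - \<delta>)..ereal (x + \<delta>)} \<subseteq> {c..d}" "(laplace_quotient \<delta> (increment U x 1) \<longlongrightarrow> l) at_top"
    using assms(2) unfolding has_LD1_continuous_iff[OF F] U_def[abs_def] by blast
  obtain \<eta> where \<eta>: "0 < \<eta>" "{ereal (x - \<eta>)..ereal (x + \<eta>)} \<subseteq> {c..d}" "(laplace_quotient \<eta> (increment U x 1) \<longlongrightarrow> m) at_top"
    using assms(3) unfolding has_LD1_continuous_iff[OF F] U_def[abs_def] by blast
  show ?thesis
  proof (cases "\<eta> \<le> \<delta>")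
    case True
    show ?thesis by (rule eq[OF \<delta>(3) \<eta>(3,1) True \<delta>(2)])
  next
    case False
    then have "\<delta> \<le> \<eta>" by simp
    from eq[OF \<eta>(3) \<delta>(3,1) this \<eta>(2)] show ?thesis ..
  qed
qed

text \<open>
  Countably many compact intervals with rational endpoints exhaust the interior, so the result for
  compact intervals extends to every interval.
\<close>
lemma LP_indefinite_has_LD1_ae:
  assumes \<Phi>: "LP_indefinite g a b \<Phi>"
  shows "AE x in lebesgue. a < ereal x \<and> ereal x < b \<longrightarrow> has_LD1 a b \<Phi> x (g x)"
proof -
  define U where "U t = \<Phi> (ereal t)" for t
  define good where "good p q x \<longleftrightarrow> (p < x \<and> x < q \<longrightarrow>
    (\<forall>\<sigma> \<delta>. side_within p q x \<sigma> \<delta> \<longrightarrow> (laplace_quotient \<delta> (increment U x \<sigma>) \<longlongrightarrow> g x) at_top))" for p q x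
  have good: "AE x in lebesgue. good p q x" if pq: "p \<le> q" "a \<le> ereal p" "ereal q \<le> b" for p q
  proof -
    have fam: "LP_compact g u v (U v - U u)" if "p \<le> u" "u \<le> v" "v \<le> q" for u v
      unfolding U_def using that pq
      by (intro LP_indefiniteD(2)[OF \<Phi>]) (auto intro: order_trans[of a "ereal p"] order_trans[of _ "ereal q" b])
    show ?thesis
      unfolding good_def
      by (rule LP_primitive_derivative_ae[OF LP_compact_family_primitive[OF fam pq(1)]])
  qed
  have "AE x in lebesgue. \<forall>z\<in>{z :: rat \<times> rat. fst z \<le> snd z \<and> a \<le> ereal (of_rat (fst z)) \<and> ereal (of_rat (snd z)) \<le> b}.
      good (of_rat (fst z)) (of_rat (snd z)) x"
  proof (rule AE_ball_countable')
    fix z :: "rat \<times> rat"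
    assume "z \<in> {z. fst z \<le> snd z \<and> a \<le> ereal (of_rat (fst z)) \<and> ereal (of_rat (snd z)) \<le> b}"
    then show "AE x in lebesgue. good (of_rat (fst z)) (of_rat (snd z)) x"
      by (intro good) (simp_all add: of_rat_less_eq)
  qed simp
  then show ?thesis
  proof (rule eventually_mono, intro impI)
    fix x assume *: "\<forall>z\<in>{z :: rat \<times> rat. fst z \<le> snd z \<and> a \<le> ereal (of_rat (fst z)) \<and> ereal (of_rat (snd z)) \<le> b}.
      good (of_rat (fst z)) (of_rat (snd z)) x" and x: "a < ereal x \<and> ereal x < b"
    obtain p :: rat where p: "a < ereal (of_rat p)" "of_rat p < x"
      using ereal_dense3[of a "ereal x"] x by auto
    obtain q :: rat where q: "x < of_rat q" "ereal (of_rat q) < b"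
      using ereal_dense3[of "ereal x" b] x by auto
    have "(of_rat p :: real) < of_rat q" using p q by linarith
    then have "p \<le> q" by (simp add: of_rat_less)
    then have g: "good (of_rat p) (of_rat q) x"
      using bspec[OF *, of "(p, q)"] p(1) q(2) by (simp add: less_imp_le)
    define \<delta> where "\<delta> = min (x - of_rat p) (of_rat q - x)"
    have \<delta>: "0 < \<delta>" "of_rat p \<le> x - \<delta>" "x + \<delta> \<le> of_rat q" using p q by (auto simp: \<delta>_def)
    have "\<forall>\<sigma>\<in>{1, - 1}. (laplace_quotient \<delta> (increment U x \<sigma>) \<longlongrightarrow> g x) at_top"
    proof
      fix \<sigma> :: real assume "\<sigma> \<in> {1, - 1}"
      then have "side_within (of_rat p) (of_rat q) x \<sigma> \<delta>"
        using \<delta> by (auto simp: side_within_def)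
      then show "(laplace_quotient \<delta> (increment U x \<sigma>) \<longlongrightarrow> g x) at_top"
        using g p(2) q(1) unfolding good_def by blast
    qed
    moreover have "a \<le> ereal (x - \<delta>)"
      by (rule order_trans[of a "ereal (of_rat p)"]) (use \<delta>(2) p(1) in auto)
    moreover have "ereal (x + \<delta>) \<le> b"
      by (rule order_trans[of _ "ereal (of_rat q)" b]) (use \<delta>(3) q(2) in auto)
    ultimately show "has_LD1 a b \<Phi> x (g x)"
      unfolding has_LD1_continuous_iff[OF LP_indefiniteD(1)[OF \<Phi>]]
      using \<delta>(1) by (intro exI[of _ \<delta>]) (auto simp: U_def[abs_def])
  qed
qed

section \<open>Primitives and differentiation under the integral sign\<close>

lemma LP_indefinite_add_const:
  assumes \<Phi>: "LP_indefinite f a b \<Phi>" and F: "\<And>x. x \<in> {a..b} \<Longrightarrow> F x = \<Phi> x + k"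
  shows "LP_indefinite f a b F"
  unfolding LP_indefinite_def
proof (intro conjI allI impI)
  show "continuous_on {a..b} F"
    by (subst continuous_on_cong[OF refl F]) (auto intro!: continuous_intros LP_indefiniteD(1)[OF \<Phi>])
  fix u v assume uv: "u \<le> v" "a \<le> ereal u" "ereal v \<le> b"
  then have "ereal u \<in> {a..b}" "ereal v \<in> {a..b}"
    by (auto intro: order_trans[of a "ereal u"] order_trans[of _ "ereal v" b])
  from F[OF this(1)] F[OF this(2)] LP_indefiniteD(2)[OF \<Phi> uv]
  show "LP_compact f u v (F (ereal v) - F (ereal u))"
    by simp
qed

lemma LP_primitive_imp_continuous: "LP_primitive a b F \<Longrightarrow> continuous_on {a..b} F"
  by (simp add: LP_primitive_def)

lemma between_limits:
  fixes a b s t :: ereal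
  assumes "s \<in> {a..b}" "t \<in> {a..b}" "min s t < x" "x < max s t"
  shows "a < x" "x < b"
  using assms by (auto simp: min_def max_def split: if_splits)

lemma LP_primitive_integral_unique:
  assumes F: "LP_primitive a b F" and st: "s \<in> {a..b}" "t \<in> {a..b}"
    and I: "has_ae_LP_integral (has_LD1 a b F) s t I"
  shows "I = F t - F s"
proof (rule has_ae_LP_integral_unique[OF I])
  show "has_ae_LP_integral (has_LD1 a b F) s t (F t - F s)"
    using F st by (simp add: LP_primitive_def)
  show "AE x in lebesgue. min s t < ereal x \<and> ereal x < max s t \<longrightarrow>
      (\<forall>v w. has_LD1 a b F x v \<longrightarrow> has_LD1 a b F x w \<longrightarrow> v = w)"
    by (intro AE_I2) (blast intro: has_LD1_unique[OF LP_primitive_imp_continuous[OF F]])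
qed

text \<open>
  The converse of the defining property of primitives: \<open>F\<close> equals an indefinite integral of \<open>g\<close> up
  to a constant, and indefinite integrals are continuous and differentiable almost everywhere.
\<close>
lemma LP_primitive_if_integral:
  assumes ab: "a < b" and g: "has_LP_integral g a b (F b - F a)"
    and F: "\<And>s t I. s \<in> {a..b} \<Longrightarrow> t \<in> {a..b} \<Longrightarrow> has_LP_integral g s t I \<Longrightarrow> I = F t - F s"
  shows "LP_primitive a b F" "AE x in lebesgue. a < ereal x \<and> ereal x < b \<longrightarrow> has_LD1 a b F x (g x)"
proof -
  obtain \<Phi> where \<Phi>: "LP_indefinite g a b \<Phi>"
    using g has_LP_integral_iff_indefinite[OF ab] by blast
  have "F x = \<Phi> x + (F a - \<Phi> a)" if "x \<in> {a..b}" for x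
    using F[OF _ that LP_indefinite_imp_has_integral_between[OF \<Phi> _ that], of a] ab
    by (simp add: less_imp_le algebra_simps)
  then have indef: "LP_indefinite g a b F"
    by (rule LP_indefinite_add_const[OF \<Phi>])
  show LD1: "AE x in lebesgue. a < ereal x \<and> ereal x < b \<longrightarrow> has_LD1 a b F x (g x)"
    by (rule LP_indefinite_has_LD1_ae[OF indef])
  have between: "has_ae_LP_integral (has_LD1 a b F) u v (F v - F u)" if uv: "u \<in> {a..b}" "v \<in> {a..b}" for u v
    unfolding has_ae_LP_integral_def
  proof (intro exI[of _ g] conjI)
    show "AE x in lebesgue. min u v < ereal x \<and> ereal x < max u v \<longrightarrow> has_LD1 a b F x (g x)"
      using LD1 by eventually_elim (blast intro: between_limits[OF uv])
    show "has_LP_integral g u v (F v - F u)"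
      by (rule LP_indefinite_imp_has_integral_between[OF indef uv])
  qed
  have "AE x in lebesgue. a < ereal x \<and> ereal x < b \<longrightarrow> (\<exists>l. has_LD1 a b F x l)"
    using LD1 by eventually_elim blast
  moreover have "has_ae_LP_integral (has_LD1 a b F) a b (F b - F a)"
    by (rule between) (use ab in auto)
  ultimately show "LP_primitive a b F"
    unfolding LP_primitive_def using LP_indefiniteD(1)[OF indef] between by blast
qed

lemma LP_primitive_point: "LP_primitive a a F"
proof -
  have "AE x in lebesgue. min a a < ereal x \<and> ereal x < max a a \<longrightarrow> has_LD1 a a F x 0"
    by (intro AE_I2) auto
  then have degenerate: "has_ae_LP_integral (has_LD1 a a F) a a 0"
    unfolding has_ae_LP_integral_def by (intro exI[of _ "\<lambda>x. 0"]) (simp add: has_LP_integral_refl_iff)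
  moreover have "AE x in lebesgue. a < ereal x \<and> ereal x < a \<longrightarrow> (\<exists>l. has_LD1 a a F x l)"
    by (intro AE_I2) auto
  ultimately show ?thesis
    by (auto simp: LP_primitive_def)
qed

text \<open>
  By the defining property of the primitives \<open>f (\<cdot>, y)\<close>, integrating in \<open>x\<close> first always gives
  \<open>F t - F s\<close>. Hence equality of the iterated integrals says precisely that \<open>F\<close> is recovered from
  the function \<open>G\<close> below, the integral in \<open>y\<close> of the partial derivative.
\<close>
theorem theorem4p1:
  fixes \<alpha> \<beta> a b :: ereal
    and f :: "ereal \<times> ereal \<Rightarrow> real"
    and F :: "ereal \<Rightarrow> real"
  assumes "\<alpha> \<le> \<beta>" and "a \<le> b"
    and "AE y in lebesgue. a < ereal y \<and> ereal y < b \<longrightarrow> LP_primitive \<alpha> \<beta> (\<lambda>x. f (x, ereal y))"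
    and "\<And>x. x \<in> {\<alpha>..\<beta>} \<Longrightarrow> has_LP_integral (\<lambda>y. f (x, ereal y)) a b (F x)"
  shows "(LP_primitive \<alpha> \<beta> F \<and>
          (AE x in lebesgue. \<alpha> < ereal x \<and> ereal x < \<beta> \<longrightarrow>
             (\<exists>l. has_LD1 \<alpha> \<beta> F x l \<and>
                  has_ae_LP_integral (\<lambda>y. has_LD1 \<alpha> \<beta> (\<lambda>\<xi>. f (\<xi>, ereal y)) x) a b l)))
     \<longleftrightarrow>
         (\<forall>s\<in>{\<alpha>..\<beta>}. \<forall>t\<in>{\<alpha>..\<beta>}. \<exists>I.
            has_ae_LP_integral (\<lambda>x. has_ae_LP_integral
              (\<lambda>y. has_LD1 \<alpha> \<beta> (\<lambda>\<xi>. f (\<xi>, ereal y)) x) a b) s t I \<and>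
            has_ae_LP_integral (\<lambda>y. has_ae_LP_integral
              (\<lambda>x. has_LD1 \<alpha> \<beta> (\<lambda>\<xi>. f (\<xi>, ereal y)) x) s t) a b I)"
proof -
  note ab = \<open>a \<le> b\<close> and prim = assms(3) and F_int = assms(4)
  have minmax: "min a b = a" "max a b = b"
    using ab by (simp_all add: min_def max_def)
  define G where "G x = has_ae_LP_integral (\<lambda>y. has_LD1 \<alpha> \<beta> (\<lambda>\<xi>. f (\<xi>, ereal y)) x) a b" for x
  have G_unique: "l = m" if "G x l" "G x m" for x l m
  proof (rule has_ae_LP_integral_unique[OF that[unfolded G_def]])
    show "AE y in lebesgue. min a b < ereal y \<and> ereal y < max a b \<longrightarrow>
        (\<forall>v w. has_LD1 \<alpha> \<beta> (\<lambda>\<xi>. f (\<xi>, ereal y)) x v \<longrightarrow> has_LD1 \<alpha> \<beta> (\<lambda>\<xi>. f (\<xi>, ereal y)) x w \<longrightarrow> v = w)"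
      unfolding minmax using prim
      by eventually_elim (blast intro: has_LD1_unique dest: LP_primitive_imp_continuous)
  qed
  have inner_x_first: "has_ae_LP_integral (\<lambda>y. has_ae_LP_integral
        (\<lambda>x. has_LD1 \<alpha> \<beta> (\<lambda>\<xi>. f (\<xi>, ereal y)) x) s t) a b I \<longleftrightarrow> I = F t - F s"
    if st: "s \<in> {\<alpha>..\<beta>}" "t \<in> {\<alpha>..\<beta>}" for s t I
  proof -
    let ?P = "\<lambda>y. has_ae_LP_integral (\<lambda>x. has_LD1 \<alpha> \<beta> (\<lambda>\<xi>. f (\<xi>, ereal y)) x) s t"
    have "has_LP_integral (\<lambda>y. f (t, ereal y) - f (s, ereal y)) a b (F t - F s)"
      by (rule has_LP_integral_diff[OF ab F_int[OF st(2)] F_int[OF st(1)]])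
    moreover have "AE y in lebesgue. min a b < ereal y \<and> ereal y < max a b \<longrightarrow> ?P y (f (t, ereal y) - f (s, ereal y))"
      unfolding minmax using prim
    proof eventually_elim
      case (elim y)
      then show ?case
        using st by (auto simp: LP_primitive_def)
    qed
    ultimately have "has_ae_LP_integral ?P a b (F t - F s)"
      unfolding has_ae_LP_integral_def[of ?P]
      by (intro exI[of _ "\<lambda>y. f (t, ereal y) - f (s, ereal y)"] conjI)
    moreover have "AE y in lebesgue. min a b < ereal y \<and> ereal y < max a b \<longrightarrow> (\<forall>v w. ?P y v \<longrightarrow> ?P y w \<longrightarrow> v = w)"
      unfolding minmax using prim
    proof eventually_elim
      case (elim y)
      then show ?case
        using LP_primitive_integral_unique[OF _ st] by metis
    qed
    ultimately show ?thesis
      using has_ae_LP_integral_unique[of ?P a b] by blast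
  qed
  have "(LP_primitive \<alpha> \<beta> F \<and> (AE x in lebesgue. \<alpha> < ereal x \<and> ereal x < \<beta> \<longrightarrow> (\<exists>l. has_LD1 \<alpha> \<beta> F x l \<and> G x l)))
      \<longleftrightarrow> (\<forall>s\<in>{\<alpha>..\<beta>}. \<forall>t\<in>{\<alpha>..\<beta>}. has_ae_LP_integral G s t (F t - F s))" (is "?L \<longleftrightarrow> ?R")
  proof
    assume L: ?L
    then have F_cont: "continuous_on {\<alpha>..\<beta>} F" by (simp add: LP_primitive_imp_continuous)
    show ?R
    proof (intro ballI)
      fix s t assume st: "s \<in> {\<alpha>..\<beta>}" "t \<in> {\<alpha>..\<beta>}"
      then have "has_ae_LP_integral (has_LD1 \<alpha> \<beta> F) s t (F t - F s)"
        using L by (simp add: LP_primitive_def)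
      then obtain g where g: "AE x in lebesgue. min s t < ereal x \<and> ereal x < max s t \<longrightarrow> has_LD1 \<alpha> \<beta> F x (g x)"
          "has_LP_integral g s t (F t - F s)"
        by (auto simp: has_ae_LP_integral_def)
      have "AE x in lebesgue. \<alpha> < ereal x \<and> ereal x < \<beta> \<longrightarrow> (\<exists>l. has_LD1 \<alpha> \<beta> F x l \<and> G x l)"
        using L by blast
      with g(1) have "AE x in lebesgue. min s t < ereal x \<and> ereal x < max s t \<longrightarrow> G x (g x)"
      proof eventually_elim
        case (elim x)
        show ?case
        proof
          assume x: "min s t < ereal x \<and> ereal x < max s t"
          with elim(2) between_limits[OF st, of "ereal x"] obtain l where "has_LD1 \<alpha> \<beta> F x l" "G x l" by blast
          moreover have "has_LD1 \<alpha> \<beta> F x (g x)" using elim(1) x by blast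
          ultimately show "G x (g x)" using has_LD1_unique[OF F_cont] by blast
        qed
      qed
      with g(2) show "has_ae_LP_integral G s t (F t - F s)"
        by (auto simp: has_ae_LP_integral_def)
    qed
  next
    assume R: ?R
    show ?L
    proof (cases "\<alpha> = \<beta>")
      case True
      then show ?thesis
        by (auto simp: LP_primitive_point intro!: AE_I2)
    next
      case False
      with \<open>\<alpha> \<le> \<beta>\<close> have \<alpha>\<beta>: "\<alpha> < \<beta>" by simp
      then have "has_ae_LP_integral G \<alpha> \<beta> (F \<beta> - F \<alpha>)"
        using R by simp
      then obtain g where g: "AE x in lebesgue. \<alpha> < ereal x \<and> ereal x < \<beta> \<longrightarrow> G x (g x)"
          "has_LP_integral g \<alpha> \<beta> (F \<beta> - F \<alpha>)"
        using \<alpha>\<beta> by (auto simp: has_ae_LP_integral_def min_def max_def less_imp_le)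
      \<comment> \<open>The integrands for different limits are all values of \<open>G\<close>, so one \<open>g\<close> serves them all.\<close>
      have g_int: "I = F t - F s" if st: "s \<in> {\<alpha>..\<beta>}" "t \<in> {\<alpha>..\<beta>}" and I: "has_LP_integral g s t I" for s t I
      proof (rule has_ae_LP_integral_unique)
        have "AE x in lebesgue. min s t < ereal x \<and> ereal x < max s t \<longrightarrow> G x (g x)"
          using g(1) by eventually_elim (blast intro: between_limits[OF st])
        with I show "has_ae_LP_integral G s t I"
          unfolding has_ae_LP_integral_def by blast
        show "has_ae_LP_integral G s t (F t - F s)"
          using R st by blast
        show "AE x in lebesgue. min s t < ereal x \<and> ereal x < max s t \<longrightarrow> (\<forall>v w. G x v \<longrightarrow> G x w \<longrightarrow> v = w)"
          by (intro AE_I2) (blast intro: G_unique)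
      qed
      have "LP_primitive \<alpha> \<beta> F"
        by (rule LP_primitive_if_integral(1)[OF \<alpha>\<beta> g(2)]) (rule g_int)
      moreover have "AE x in lebesgue. \<alpha> < ereal x \<and> ereal x < \<beta> \<longrightarrow> has_LD1 \<alpha> \<beta> F x (g x)"
        by (rule LP_primitive_if_integral(2)[OF \<alpha>\<beta> g(2)]) (rule g_int)
      with g(1) have "AE x in lebesgue. \<alpha> < ereal x \<and> ereal x < \<beta> \<longrightarrow> (\<exists>l. has_LD1 \<alpha> \<beta> F x l \<and> G x l)"
        by eventually_elim blast
      ultimately show ?thesis ..
    qed
  qed
  then show ?thesis
    unfolding G_def[abs_def] using inner_x_first by auto
qed

end
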